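(* Let $K:\mathbb{R}\to\mathbb{C}$ be a generalized positive definite (gPD) kernel for which $\lambda=\mathcal{F}^{-1}[K]\in\mathcal{M}_+^{(1)}(\mathbb{R})$, let $c_1\ge0$ and let $c_0\in\mathbb{C}$ with $\operatorname{Im}c_0\ge0$. Consider the equation $$y(t)=c_1\dot x(t)-ic_0x(t)+\int_0^tK(t-\tau)x(\tau)\,d\tau,\qquad x(0)=x_0\ \ (\text{if }c_1\neq0),\qquad(\ast)$$ where the source $y$ is a sufficiently regular function on $\mathbb{R}_+=[0,\infty)$. Suppose that $(\mu,\zeta_0,\zeta_1)=\mathcal{B}_{\mathbb{R}}[\lambda,c_0,c_1]$ is well-defined, and write $J=\mathcal{F}[\mu]$. If $\mu\in\mathcal{M}_+^{(1)}(\mathbb{R})$, then $(\ast)$ is satisfied by the function $x$ given by $$\pi^2x(t)=\zeta_1\dot y(t)-i\zeta_0y(t)+\int_0^tJ(t-\tau)y(\tau)\,d\tau+c_1x_0J(t).$$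
   Context: A function $F:\mathbb{R}\to\mathbb{C}$ is positive (semi)definite (PD) if for all finite $\{t_1,\dots,t_N\}\subset\mathbb{R}$ the matrix $A_{jk}=F(t_j-t_k)$ is positive semidefinite (such $F$ are understood as Fourier transforms of finite non-negative Borel measures, by Bochner's theorem). A kernel $K:\mathbb{R}\to\mathbb{C}$ is gPD if $K=(1-\frac{d^2}{dt^2})^{1/2}F$ weakly for a PD kernel $F$; equivalently $K=\mathcal{F}[\lambda]$ for some $\lambda\in\mathcal{M}_+^{(1)}(\mathbb{R})$. Here $\mathcal{F}[\lambda](t)=\int e^{-i\omega t}\,d\lambda(\omega)$, interpreted weakly (as a tempered distribution) when $\lambda$ is not finite; gPD kernels are treated as classical functions. $\mathcal{M}_+^{(1)}(\mathbb{R})$ is the set of nonzero non-negative locally finite Borel measures $\lambda$ on $\mathbb{R}$ with $\int(1+s^2)^{-1/2}\,d\lambda(s)<\infty$. For such $\lambda$ and $z\in\mathbb{H}=\{\operatorname{Im}z>0\}$, $Q_{\mathbb{R}}[\lambda](z)=\int\frac{i\,d\lambda(s)}{\pi(z-s)}$. The triple $(\mu,\zeta_0,\zeta_1)=\mathcal{B}_{\mathbb{R}}[\lambda,c_0,c_1]$ is the (unique, when it exists) triple with $\zeta_1\ge0$ satisfying $$\big(Q_{\mathbb{R}}[\lambda](z)-i\pi^{-1}c_0-i\pi^{-1}c_1z\big)\big(Q_{\mathbb{R}}[\mu](z)-i\pi^{-1}\zeta_0-i\pi^{-1}\zeta_1z\big)=1\quad\text{for all }z\in\mathbb{H},$$ with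 $\zeta_0\in\mathbb{R}$ when $c_0\in\mathbb{R}$, and $\zeta_0\in\mathbb{C}$, $\operatorname{Im}\zeta_0\ge0$ in general. "Sufficiently regular" means that $y$ is regular enough for $(\ast)$ to have a classical solution $x$. *)

theory Defs
  imports "HOL-Analysis.Analysis"
begin

definition locally_finite_borel :: "real measure \<Rightarrow> bool" where
  "locally_finite_borel lam \<longleftrightarrow>
     sets lam = sets borel \<and> (\<forall>C. compact C \<longrightarrow> emeasure lam C < \<infinity>)"

definition M1_plus :: "real measure set" where
  "M1_plus = {lam. locally_finite_borel lam \<and> emeasure lam UNIV \<noteq> 0 \<and>
     (\<integral>\<^sup>+ s. ennreal ((1 + s\<^sup>2) powr (- 1 / 2)) \<partial>lam) < \<infinity>}"

definition Q_R :: "real measure \<Rightarrow> complex \<Rightarrow> complex" where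
  "Q_R lam z = (CLINT s|lam. \<i> / (of_real pi * (z - of_real s)))"

text \<open>The map \<open>B\<close> as a relation, since it is only partially defined. \<^const>\<open>Q_R\<close> is
  meaningful on \<^const>\<open>M1_plus\<close>, to which it is applied here.\<close>

definition B_R ::
  "real measure \<Rightarrow> complex \<Rightarrow> real \<Rightarrow> real measure \<Rightarrow> complex \<Rightarrow> real \<Rightarrow> bool" where
  "B_R lam c0 c1 mu \<zeta>0 \<zeta>1 \<longleftrightarrow>
     locally_finite_borel mu \<and> \<zeta>1 \<ge> 0 \<and> Im \<zeta>0 \<ge> 0 \<and> (c0 \<in> \<real> \<longrightarrow> \<zeta>0 \<in> \<real>) \<and>
     (\<forall>z. Im z > 0 \<longrightarrow>
        (Q_R lam z - \<i> / of_real pi * c0 - \<i> / of_real pi * of_real c1 * z) *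
        (Q_R mu z - \<i> / of_real pi * \<zeta>0 - \<i> / of_real pi * of_real \<zeta>1 * z) = 1)"

definition smooth :: "(real \<Rightarrow> complex) \<Rightarrow> bool" where
  "smooth \<phi> \<longleftrightarrow>
     (\<forall>n t. ((\<lambda>f s. vector_derivative f (at s)) ^^ n) \<phi> differentiable (at t))"

definition test_function :: "(real \<Rightarrow> complex) \<Rightarrow> bool" where
  "test_function \<phi> \<longleftrightarrow> smooth \<phi> \<and> (\<exists>R. \<forall>t. \<bar>t\<bar> > R \<longrightarrow> \<phi> t = 0)"

definition locally_integrable :: "(real \<Rightarrow> complex) \<Rightarrow> bool" where
  "locally_integrable K \<longleftrightarrow> (\<forall>a b. set_integrable lborel {a..b} K)"

definition fourier :: "(real \<Rightarrow> complex) \<Rightarrow> real \<Rightarrow> complex" where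
  "fourier \<phi> \<omega> = (CLINT t|lborel. exp (- \<i> * of_real \<omega> * of_real t) * \<phi> t)"

text \<open>\<open>K\<close> is the Fourier transform of \<open>lam\<close>. If \<open>lam\<close> is finite this is a pointwise equation
  (so \<open>K\<close> is the continuous representative). Otherwise \<open>K\<close> is a locally integrable function that
  represents the tempered distribution sending \<open>\<phi>\<close> to the \<open>lam\<close>-integral of its Fourier
  transform. Testing against compactly supported smooth functions is enough, because they are
  dense in the Schwartz space, and it avoids asking for absolute convergence of the pairing of
  \<open>K\<close> with every Schwartz function.\<close>

definition is_fourier_of :: "(real \<Rightarrow> complex) \<Rightarrow> real measure \<Rightarrow> bool" where
  "is_fourier_of K lam \<longleftrightarrow>
     (if finite_measure lam
      then \<forall>t. K t = (CLINT \<omega>|lam. exp (- \<i> * of_real \<omega> * of_real t))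
      else locally_integrable K \<and>
           (\<forall>\<phi>. test_function \<phi> \<longrightarrow>
              (CLINT t|lborel. K t * \<phi> t) = (CLINT \<omega>|lam. fourier \<phi> \<omega>)))"

text \<open>Continuity is the regularity under which Bochner's theorem identifies these functions
  with the Fourier transforms of finite non-negative measures.\<close>

definition PD :: "(real \<Rightarrow> complex) \<Rightarrow> bool" where
  "PD F \<longleftrightarrow> continuous_on UNIV F \<and>
     (\<forall>T c. finite T \<longrightarrow> (\<Sum>s\<in>T. \<Sum>t\<in>T. cnj (c s) * F (s - t) * c t) \<in> \<real>\<^sub>\<ge>\<^sub>0)"

text \<open>The operator \<open>(1 - d\<^sup>2/dt\<^sup>2)\<^bsup>1/2\<^esup>\<close> as a Fourier multiplier. Its symbol is even, so
  it is its own transpose for the bilinear pairing; hence the weak equation in \<open>gPD\<close>.\<close>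

definition sqrt_one_minus_laplacian :: "(real \<Rightarrow> complex) \<Rightarrow> real \<Rightarrow> complex" where
  "sqrt_one_minus_laplacian \<phi> t =
     1 / of_real (2 * pi) *
     (CLINT \<omega>|lborel. exp (\<i> * of_real \<omega> * of_real t) * of_real (sqrt (1 + \<omega>\<^sup>2)) * fourier \<phi> \<omega>)"

definition gPD :: "(real \<Rightarrow> complex) \<Rightarrow> bool" where
  "gPD K \<longleftrightarrow> locally_integrable K \<and>
     (\<exists>F. PD F \<and> (\<forall>\<phi>. test_function \<phi> \<longrightarrow>
        (CLINT t|lborel. K t * \<phi> t) = (CLINT t|lborel. F t * sqrt_one_minus_laplacian \<phi> t)))"

text \<open>Derivatives are relative to the half line, so one-sided at \<open>0\<close>; values at negative
  arguments play no role.\<close>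

abbreviation half_line_deriv :: "(real \<Rightarrow> complex) \<Rightarrow> real \<Rightarrow> complex" where
  "half_line_deriv f t \<equiv> vector_derivative f (at t within {0..})"

definition volterra_conv :: "(real \<Rightarrow> complex) \<Rightarrow> (real \<Rightarrow> complex) \<Rightarrow> real \<Rightarrow> complex" where
  "volterra_conv K x t = (CLINT \<tau>:{0..t}|lborel. K (t - \<tau>) * x \<tau>)"

definition classical_solution ::
  "(real \<Rightarrow> complex) \<Rightarrow> complex \<Rightarrow> real \<Rightarrow> complex \<Rightarrow> (real \<Rightarrow> complex) \<Rightarrow> (real \<Rightarrow> complex) \<Rightarrow> bool"
where
  "classical_solution K c0 c1 x0 y x \<longleftrightarrow>
     continuous_on {0..} x \<and>
     (c1 \<noteq> 0 \<longrightarrow> x 0 = x0 \<and> x differentiable_on {0..} \<and> continuous_on {0..} (half_line_deriv x)) \<and>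
     (\<forall>t\<ge>0. y t = of_real c1 * half_line_deriv x t - \<i> * c0 * x t + volterra_conv K x t)"

definition sufficiently_regular ::
  "(real \<Rightarrow> complex) \<Rightarrow> complex \<Rightarrow> real \<Rightarrow> complex \<Rightarrow> (real \<Rightarrow> complex) \<Rightarrow> bool" where
  "sufficiently_regular K c0 c1 x0 y \<longleftrightarrow> (\<exists>x. classical_solution K c0 c1 x0 y x)"

end

theory Submission
  imports Defs
begin

text \<open>
  Write \<open>a \<star> b\<close> for the convolution \<open>volterra_conv a b\<close> on the half line and \<open>\<one>\<close> for the constant
  function one, so that \<open>\<one> \<star> f\<close> is the primitive of \<open>f\<close> that vanishes at \<open>0\<close>. Formally, the
  Laplace transform of \<open>K\<close> at \<open>s > 0\<close> is \<open>\<pi> Q_R lam (i s)\<close>. The equation is then convolution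
  with the distribution \<open>c1 \<delta>' - i c0 \<delta> + K\<close>, with Laplace transform
  \<open>\<pi> (Q_R lam (i s) - i c0 / \<pi> + c1 s / \<pi>)\<close>, and the relation \<open>B_R\<close> says that
  \<open>\<zeta>1 \<delta>' - i \<zeta>0 \<delta> + J\<close> is \<open>\<pi>\<^sup>2\<close> times its convolution inverse. The claimed formula for \<open>x\<close> is
  the result of applying that inverse to \<open>y\<close>; the term with \<open>x0\<close> accounts for the initial value.

  Distributions are avoided by integrating twice. The function
  \<open>A = c1 + (- i c0) (\<one> \<star> \<one>) + \<one> \<star> (\<one> \<star> K)\<close>, called \<open>twice_integrated_kernel\<close> below, is
  continuous, and so is its counterpart \<open>B\<close> for \<open>J\<close>, \<open>\<zeta>0\<close>, \<open>\<zeta>1\<close>. Their Laplace transforms have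
  product \<open>\<pi>\<^sup>2 / s\<^sup>4\<close>, so by injectivity of the Laplace transform (\<open>laplace_eq_0_imp_eq_0\<close>) the
  convolution \<open>B \<star> A\<close> is \<open>\<pi>\<^sup>2\<close> times the fourfold convolution power of \<open>\<one>\<close>
  (\<open>twice_integrated_kernels_inverse\<close>). To compute the transform of \<open>A\<close> when \<open>lam\<close> is infinite,
  and \<open>K\<close> is only known as a distribution, one first shows that \<open>\<one> \<star> K\<close> is the absolutely
  convergent integral of \<open>\<one> \<star> exp (- i \<omega> \<cdot>)\<close> against \<open>lam\<close>
  (\<open>primitive_eq_transform_primitive\<close>), by testing against smooth approximations of the indicator
  function of an interval. The integrability condition in \<open>M1_plus\<close> is exactly what is needed there.

  Let now \<open>\<xi>\<close> be a classical solution, which exists as \<open>y\<close> is sufficiently regular. Integrating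
  its equation twice gives \<open>\<one> \<star> (\<one> \<star> y) + c1 x0 (\<one> \<star> \<one>) = A \<star> \<xi>\<close>. Convolving with \<open>B\<close> and removing
  two integrations gives \<open>B \<star> y + c1 x0 B = \<pi>\<^sup>2 \<one> \<star> (\<one> \<star> \<xi>)\<close>
  (\<open>twice_integrated_solution_formula\<close>). It remains to differentiate this identity twice, which is
  legitimate for one of two reasons.
  If \<open>c1 > 0\<close>, the behaviour of \<open>B_R\<close> along the imaginary axis forces \<open>mu\<close> to be finite and
  \<open>\<zeta>0 = \<zeta>1 = 0\<close> (\<open>B_R_c1_pos\<close>), so \<open>J\<close> is continuous and \<open>B = \<one> \<star> (\<one> \<star> J)\<close>.
  If \<open>c1 = 0\<close>, the term with \<open>B\<close> itself is absent, and differentiating once writes \<open>\<zeta>1 y\<close> as the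
  primitive of a continuous function; thus \<open>y\<close> is differentiable when \<open>\<zeta>1\<close> is not zero.
  In both cases \<open>x = \<xi>\<close> on the half line, so \<open>x\<close> is itself a classical solution.
\<close>

section \<open>Convolution on the half line\<close>

abbreviation primitive :: "(real \<Rightarrow> complex) \<Rightarrow> real \<Rightarrow> complex" where
  "primitive \<equiv> volterra_conv (\<lambda>_. 1)"

definition half_line_integrable :: "(real \<Rightarrow> complex) \<Rightarrow> bool" where
  "half_line_integrable f \<longleftrightarrow> (\<forall>T. set_integrable lborel {0..T} f)"

lemma half_line_integrableD: "half_line_integrable f \<Longrightarrow> set_integrable lborel {0..T} f"
  by (simp add: half_line_integrable_def)

lemma continuous_imp_half_line_integrable:
  assumes "continuous_on {0..} f"
  shows "half_line_integrable f"
  unfolding half_line_integrable_def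
  using assms by (auto intro!: borel_integrable_atLeastAtMost' intro: continuous_on_subset)

text \<open>The integrand of a convolution, integrable in both variables jointly; every exchange
  of integrals for convolutions rests on it.\<close>

lemma integrable_shear:
  fixes F G :: "real \<Rightarrow> complex"
  assumes F: "integrable lborel F" and G: "integrable lborel G"
  shows "integrable (lborel \<Otimes>\<^sub>M lborel) (\<lambda>(\<tau>, s). F (s - \<tau>) * G \<tau>)"
proof (rule lborel_pair.Fubini_integrable)
  have [measurable]: "F \<in> borel_measurable borel" "G \<in> borel_measurable borel"
    using F G by auto
  show "(\<lambda>(\<tau>, s). F (s - \<tau>) * G \<tau>) \<in> borel_measurable (lborel \<Otimes>\<^sub>M lborel)"
    by measurable
  have sh: "integrable lborel (\<lambda>s. F (s - \<tau>))" for \<tau>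
    using lborel_integrable_real_affine[OF F, of 1 "-\<tau>"] by (simp add: algebra_simps)
  have "(\<integral>s. norm (F (s - \<tau>)) \<partial>lborel) = (\<integral>s. norm (F s) \<partial>lborel)" for \<tau>
    using lborel_integral_real_affine[of 1 "\<lambda>s. norm (F s)" "-\<tau>"]
    by (simp add: algebra_simps)
  then show "integrable lborel (\<lambda>\<tau>. LINT s|lborel. norm (case (\<tau>, s) of (\<tau>, s) \<Rightarrow> F (s - \<tau>) * G \<tau>))"
    using G by (simp add: norm_mult)
  show "AE \<tau> in lborel. integrable lborel (\<lambda>s. case (\<tau>, s) of (\<tau>, s) \<Rightarrow> F (s - \<tau>) * G \<tau>)"
    using sh by simp
qed

lemma volterra_conv_commute: "volterra_conv f g t = volterra_conv g f t"
proof -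
  have "volterra_conv f g t = (\<integral>\<tau>. indicator {0..t} \<tau> *\<^sub>R (f (t - \<tau>) * g \<tau>) \<partial>lborel)"
    by (simp add: volterra_conv_def set_lebesgue_integral_def)
  also have "\<dots> = (\<integral>\<tau>. indicator {0..t} (t - \<tau>) *\<^sub>R (f \<tau> * g (t - \<tau>)) \<partial>lborel)"
    using lborel_integral_real_affine[of "-1" "\<lambda>\<tau>. indicator {0..t} \<tau> *\<^sub>R (f (t - \<tau>) * g \<tau>)" t]
    by simp
  also have "\<dots> = volterra_conv g f t"
    unfolding volterra_conv_def set_lebesgue_integral_def
    by (intro Bochner_Integration.integral_cong) (auto simp: indicator_def mult.commute)
  finally show ?thesis .
qed

lemma volterra_conv_cong:
  assumes "\<And>s. 0 \<le> s \<Longrightarrow> s \<le> t \<Longrightarrow> f s = f' s" "\<And>s. 0 \<le> s \<Longrightarrow> s \<le> t \<Longrightarrow> g s = g' s"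
  shows "volterra_conv f g t = volterra_conv f' g' t"
  unfolding volterra_conv_def using assms
  by (intro set_lebesgue_integral_cong) auto

text \<open>Only values on \<open>{0..T}\<close> enter, so locally integrable factors may be
  replaced by integrable ones on the whole line, where translation invariance and Fubini
  apply.\<close>

lemma volterra_conv_eq_integral_truncated:
  assumes "s \<le> T"
  shows "volterra_conv f g s =
    (\<integral>\<tau>. (indicator {0..T} (s - \<tau>) *\<^sub>R f (s - \<tau>)) * (indicator {0..T} \<tau> *\<^sub>R g \<tau>) \<partial>lborel)"
  unfolding volterra_conv_def set_lebesgue_integral_def
  using assms by (intro Bochner_Integration.integral_cong) (auto simp: indicator_def)

text \<open>Local integrability of two factors suffices because the third one is bounded on
  compact sets: the absolute integrand is then dominated by that of a convolution of two
  integrable functions.\<close>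

lemma volterra_conv_left_commute:
  assumes f: "half_line_integrable f" and g: "half_line_integrable g" and h: "continuous_on {0..} h"
  shows "volterra_conv (volterra_conv f g) h t = volterra_conv g (volterra_conv f h) t"
proof -
  define F where "F s = indicator {0..t} s *\<^sub>R f s" for s
  define G where "G s = indicator {0..t} s *\<^sub>R g s" for s
  define H where "H s = indicator {0..t} s *\<^sub>R h s" for s
  have F: "integrable lborel F" and G: "integrable lborel G" and H: "integrable lborel H"
    using half_line_integrableD[OF f] half_line_integrableD[OF g]
      half_line_integrableD[OF continuous_imp_half_line_integrable[OF h]]
    by (auto simp: set_integrable_def F_def[abs_def] G_def[abs_def] H_def[abs_def])
  have [measurable]: "F \<in> borel_measurable borel" "G \<in> borel_measurable borel"
     "H \<in> borel_measurable borel"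
    using F G H by auto
  have "compact (h ` {0..t})"
    using h by (intro compact_continuous_image) (auto intro: continuous_on_subset)
  then obtain M where M: "\<And>s. s \<in> {0..t} \<Longrightarrow> norm (h s) \<le> M"
    by (meson bounded_iff compact_imp_bounded image_eqI)
  define M' where "M' = max M 0"
  have M': "norm (H s) \<le> M'" for s
    using M[of s] by (auto simp: H_def indicator_def M'_def)
  have int: "integrable (lborel \<Otimes>\<^sub>M lborel) (\<lambda>(\<tau>, s). F (s - \<tau>) * G \<tau> * H (t - s))"
  proof (rule Bochner_Integration.integrable_bound)
    show "integrable (lborel \<Otimes>\<^sub>M lborel) (\<lambda>x. M' *\<^sub>R (case x of (\<tau>, s) \<Rightarrow> F (s - \<tau>) * G \<tau>))"
      by (intro integrable_scaleR_right integrable_shear F G)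
    show "(\<lambda>(\<tau>, s). F (s - \<tau>) * G \<tau> * H (t - s)) \<in> borel_measurable (lborel \<Otimes>\<^sub>M lborel)"
      by measurable
    have "norm (F (s - \<tau>) * G \<tau> * H (t - s)) \<le> norm (M' *\<^sub>R (F (s - \<tau>) * G \<tau>))" for \<tau> s
    proof -
      have "norm (F (s - \<tau>) * G \<tau>) * norm (H (t - s)) \<le> norm (F (s - \<tau>) * G \<tau>) * M'"
        by (intro mult_left_mono M') auto
      moreover have "0 \<le> M'" by (simp add: M'_def)
      ultimately show ?thesis by (simp add: norm_mult mult_ac)
    qed
    then show "AE x in lborel \<Otimes>\<^sub>M lborel. norm (case x of (\<tau>, s) \<Rightarrow> F (s - \<tau>) * G \<tau> * H (t - s))
        \<le> norm (M' *\<^sub>R (case x of (\<tau>, s) \<Rightarrow> F (s - \<tau>) * G \<tau>))"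
      by auto
  qed
  have "volterra_conv (volterra_conv f g) h t = volterra_conv h (volterra_conv f g) t"
    by (rule volterra_conv_commute)
  also have "\<dots> = (\<integral>s. (\<integral>\<tau>. F (s - \<tau>) * G \<tau> * H (t - s) \<partial>lborel) \<partial>lborel)"
    unfolding volterra_conv_eq_integral_truncated[OF order_refl, of h]
  proof (intro Bochner_Integration.integral_cong refl)
    fix s
    have "volterra_conv f g s = (\<integral>\<tau>. F (s - \<tau>) * G \<tau> \<partial>lborel)" if "s \<le> t"
      unfolding F_def G_def by (rule volterra_conv_eq_integral_truncated[OF that])
    then show "indicator {0..t} (t - s) *\<^sub>R h (t - s) * (indicator {0..t} s *\<^sub>R volterra_conv f g s) =
       (\<integral>\<tau>. F (s - \<tau>) * G \<tau> * H (t - s) \<partial>lborel)"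
      by (auto simp: H_def indicator_def)
  qed
  also have "\<dots> = (\<integral>\<tau>. (\<integral>s. F (s - \<tau>) * G \<tau> * H (t - s) \<partial>lborel) \<partial>lborel)"
    by (rule lborel_pair.Fubini_integral[OF int])
  also have "\<dots> = (\<integral>\<tau>. (indicator {0..t} (t - \<tau>) *\<^sub>R volterra_conv f h (t - \<tau>)) *
      (indicator {0..t} \<tau> *\<^sub>R g \<tau>) \<partial>lborel)"
  proof (intro Bochner_Integration.integral_cong refl)
    fix \<tau>
    have "(\<integral>s. F (s - \<tau>) * G \<tau> * H (t - s) \<partial>lborel) = G \<tau> * (\<integral>s. F (s - \<tau>) * H (t - s) \<partial>lborel)"
      by (simp add: mult_ac flip: integral_mult_right_zero)
    also have "(\<integral>s. F (s - \<tau>) * H (t - s) \<partial>lborel) = (\<integral>s. H (t - \<tau> - s) * F s \<partial>lborel)"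
      using lborel_integral_real_affine[of 1 "\<lambda>s. F (s - \<tau>) * H (t - s)" \<tau>]
      by (simp add: algebra_simps)
    also have "G \<tau> * \<dots> = G \<tau> * volterra_conv f h (t - \<tau>)"
    proof (cases "0 \<le> \<tau>")
      case True
      then have "volterra_conv h f (t - \<tau>) = (\<integral>s. H (t - \<tau> - s) * F s \<partial>lborel)"
        unfolding F_def H_def by (intro volterra_conv_eq_integral_truncated) auto
      then show ?thesis by (simp add: volterra_conv_commute[of f])
    qed (simp add: G_def)
    finally show "(\<integral>s. F (s - \<tau>) * G \<tau> * H (t - s) \<partial>lborel) =
       indicator {0..t} (t - \<tau>) *\<^sub>R volterra_conv f h (t - \<tau>) * (indicator {0..t} \<tau> *\<^sub>R g \<tau>)"
      by (auto simp: G_def indicator_def)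
  qed
  also have "\<dots> = volterra_conv (volterra_conv f h) g t"
    by (rule volterra_conv_eq_integral_truncated[OF order_refl, symmetric])
  also have "\<dots> = volterra_conv g (volterra_conv f h) t"
    by (rule volterra_conv_commute)
  finally show ?thesis .
qed

lemma volterra_conv_assoc:
  assumes f: "half_line_integrable f" and g: "half_line_integrable g" and h: "continuous_on {0..} h"
  shows "volterra_conv (volterra_conv f g) h t = volterra_conv f (volterra_conv g h) t"
  using volterra_conv_left_commute[OF g f h, of t] 
  by (simp add: volterra_conv_commute[of f g, abs_def] cong: volterra_conv_cong)

lemma volterra_conv_integrable:
  assumes f: "half_line_integrable f" and h: "continuous_on {0..} h"
  shows "set_integrable lborel {0..t} (\<lambda>\<tau>. f (t - \<tau>) * h \<tau>)"
proof -
  have 1: "set_integrable lborel {0..t} f"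
    using half_line_integrableD[OF f] .
  have "compact (h ` {0..t})"
    using h by (intro compact_continuous_image) (auto intro: continuous_on_subset)
  then obtain M where M: "\<And>s. s \<in> {0..t} \<Longrightarrow> norm (h s) \<le> M"
    by (meson bounded_iff compact_imp_bounded image_eqI)
  have hm: "set_borel_measurable lborel {0..t} h"
    using half_line_integrableD[OF continuous_imp_half_line_integrable[OF h], of t]
    by (auto simp: set_integrable_def set_borel_measurable_def)
  have 2: "integrable lborel (\<lambda>\<tau>. (indicator {0..t} (t - \<tau>) *\<^sub>R f (t - \<tau>)))"
    using lborel_integrable_real_affine[OF 1[unfolded set_integrable_def], of "-1" t] by simp
  show ?thesis
    unfolding set_integrable_def
  proof (rule Bochner_Integration.integrable_bound)
    show "integrable lborel (\<lambda>\<tau>. M *\<^sub>R (indicator {0..t} (t - \<tau>) *\<^sub>R f (t - \<tau>)))"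
      using 2 by (rule integrable_scaleR_right)
    have "(\<lambda>\<tau>. (indicator {0..t} (t - \<tau>) *\<^sub>R f (t - \<tau>)) * (indicator {0..t} \<tau> *\<^sub>R h \<tau>)) \<in> borel_measurable lborel"
      using 2 hm unfolding set_borel_measurable_def by (intro borel_measurable_times) auto
    then show "(\<lambda>x. indicat_real {0..t} x *\<^sub>R (f (t - x) * h x)) \<in> borel_measurable lborel"
      by (rule iffD1[OF measurable_cong, rotated]) (auto simp: indicator_def)
    have "norm (indicat_real {0..t} x *\<^sub>R (f (t - x) * h x))
         \<le> norm (M *\<^sub>R indicat_real {0..t} (t - x) *\<^sub>R f (t - x))" for x
    proof (cases "x \<in> {0..t}")
      case True
      have "norm (f (t - x)) * norm (h x) \<le> norm (f (t - x)) * \<bar>M\<bar>"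
        using M[OF True] by (intro mult_left_mono) auto
      then show ?thesis using True by (simp add: norm_mult mult_ac indicator_def)
    qed simp
    then show "AE x in lborel. norm (indicat_real {0..t} x *\<^sub>R (f (t - x) * h x))
         \<le> norm (M *\<^sub>R indicat_real {0..t} (t - x) *\<^sub>R f (t - x))"
      by simp
  qed
qed

lemma volterra_conv_add_right:
  assumes "half_line_integrable f" "continuous_on {0..} g" "continuous_on {0..} h"
  shows "volterra_conv f (\<lambda>s. g s + h s) t = volterra_conv f g t + volterra_conv f h t"
  using set_integral_add(2)[OF volterra_conv_integrable[OF assms(1,2), of t] volterra_conv_integrable[OF assms(1,3), of t]]
  by (simp add: volterra_conv_def distrib_left)

lemma volterra_conv_mult_right: "volterra_conv f (\<lambda>s. c * g s) t = c * volterra_conv f g t"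
  unfolding volterra_conv_def by (simp add: mult.left_commute)

lemma volterra_conv_mult_left: "volterra_conv (\<lambda>s. c * f s) g t = c * volterra_conv f g t"
  using volterra_conv_mult_right[of g c f] by (simp add: volterra_conv_commute[of _ g])

text \<open>Rewriting with these rules expands a convolution by linearity in its right factor
  and discharges the continuity side conditions on the way.\<close>

lemmas volterra_conv_linear =
  volterra_conv_add_right volterra_conv_mult_right continuous_on_add continuous_on_mult_left continuous_on_const

text \<open>Dominated convergence, with \<open>f\<close> kept at a fixed argument and
  \<open>h\<close> shifted. The moving end point spoils pointwise convergence of the integrand
  at a single point only.\<close>

lemma continuous_on_volterra_conv:
  assumes f: "half_line_integrable f" and h: "continuous_on {0..} h"
  shows "continuous_on {0..} (volterra_conv f h)"
  unfolding continuous_on_sequentially comp_def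
proof (intro allI ballI impI)
  fix u :: "nat \<Rightarrow> real" and a :: real
  assume a: "a \<in> {0..}" and "(\<forall>n. u n \<in> {0..}) \<and> u \<longlonglongrightarrow> a"
  then have u0: "\<And>n. 0 \<le> u n" and ua: "u \<longlonglongrightarrow> a" by auto
  obtain T where T: "\<And>n. u n \<le> T"
    using ua by (meson Bseq_eq_bounded abs_le_iff bounded_imp_bdd_above bdd_above.E convergent_imp_Bseq convergentI order_trans rangeI)
  have "compact (h ` {0..T})"
    using h by (intro compact_continuous_image) (auto intro: continuous_on_subset)
  then obtain M where M: "\<And>s. s \<in> {0..T} \<Longrightarrow> norm (h s) \<le> M"
    by (meson bounded_iff compact_imp_bounded image_eqI)
  have vc: "volterra_conv f h t = (\<integral>\<tau>. indicator {0..t} \<tau> *\<^sub>R (h (t - \<tau>) * f \<tau>) \<partial>lborel)" for t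
    unfolding volterra_conv_commute[of f] by (simp add: volterra_conv_def set_lebesgue_integral_def)
  have meas: "(\<lambda>\<tau>. indicator {0..t} \<tau> *\<^sub>R (h (t - \<tau>) * f \<tau>)) \<in> borel_measurable lborel" for t
  proof -
    have "integrable lborel (\<lambda>\<tau>. indicator {0..t} \<tau> *\<^sub>R (f (t - \<tau>) * h \<tau>))"
      using volterra_conv_integrable[OF f h, of t] by (simp add: set_integrable_def)
    then have "integrable lborel (\<lambda>\<tau>. indicator {0..t} (t - \<tau>) *\<^sub>R (f (t - (t - \<tau>)) * h (t - \<tau>)))"
      using lborel_integrable_real_affine[of "\<lambda>\<tau>. indicator {0..t} \<tau> *\<^sub>R (f (t - \<tau>) * h \<tau>)" "-1" t]
      by simp
    then have "(\<lambda>\<tau>. indicator {0..t} (t - \<tau>) *\<^sub>R (f (t - (t - \<tau>)) * h (t - \<tau>))) \<in> borel_measurable lborel"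
      by auto
    then show ?thesis
      by (rule iffD1[OF measurable_cong, rotated]) (auto simp: indicator_def)
  qed
  show "(\<lambda>n. volterra_conv f h (u n)) \<longlonglongrightarrow> volterra_conv f h a"
    unfolding vc
  proof (rule integral_dominated_convergence)
    show "integrable lborel (\<lambda>\<tau>. M * norm (indicator {0..T} \<tau> *\<^sub>R f \<tau>))"
      using half_line_integrableD[OF f, of T] unfolding set_integrable_def
      by (intro integrable_mult_right integrable_norm)
    show "AE \<tau> in lborel. norm (indicator {0..u n} \<tau> *\<^sub>R (h (u n - \<tau>) * f \<tau>))
       \<le> M * norm (indicator {0..T} \<tau> *\<^sub>R f \<tau>)" for n
    proof (intro AE_I2)
      fix \<tau>
      show "norm (indicator {0..u n} \<tau> *\<^sub>R (h (u n - \<tau>) * f \<tau>)) \<le> M * norm (indicator {0..T} \<tau> *\<^sub>R f \<tau>)"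
      proof (cases "\<tau> \<in> {0..u n}")
        case True
        then have "norm (h (u n - \<tau>)) * norm (f \<tau>) \<le> M * norm (f \<tau>)"
          using T[of n] by (intro mult_right_mono M) auto
        then show ?thesis using True T[of n] by (simp add: indicator_def norm_mult)
      next
        case False
        have "0 \<le> M" using M[of 0] T[of 0] u0[of 0] by (meson atLeastAtMost_iff norm_ge_zero order_trans order_refl)
        then show ?thesis using False by (auto intro!: mult_nonneg_nonneg)
      qed
    qed
    have "AE \<tau> in lborel. \<tau> \<noteq> a"
      by (rule AE_lborel_singleton)
    then show "AE \<tau> in lborel. (\<lambda>n. indicator {0..u n} \<tau> *\<^sub>R (h (u n - \<tau>) * f \<tau>))
          \<longlonglongrightarrow> indicator {0..a} \<tau> *\<^sub>R (h (a - \<tau>) * f \<tau>)"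
    proof eventually_elim
      case (elim \<tau>)
      \<comment> \<open>the point \<open>a\<close> itself is excluded: there the truncated
        integrand need not converge\<close>
      consider "\<tau> < 0" | "0 \<le> \<tau>" "\<tau> < a" | "a < \<tau>" using elim by linarith
      then show ?case
      proof cases
        case 1 then show ?thesis by simp
      next
        case 2
        have ev: "eventually (\<lambda>n. \<tau> < u n) sequentially"
          using order_tendstoD(1)[OF ua] 2 by blast
        have "(\<lambda>n. h (u n - \<tau>)) \<longlonglongrightarrow> h (a - \<tau>)"
        proof (rule continuous_on_tendsto_compose[OF h])
          show "(\<lambda>n. u n - \<tau>) \<longlonglongrightarrow> a - \<tau>" by (intro tendsto_intros ua)
          show "a - \<tau> \<in> {0..}" using 2 by simp
          show "eventually (\<lambda>n. u n - \<tau> \<in> {0..}) sequentially"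
            using ev by eventually_elim auto
        qed
        then have "(\<lambda>n. h (u n - \<tau>) * f \<tau>) \<longlonglongrightarrow> h (a - \<tau>) * f \<tau>" by (intro tendsto_intros)
        then have "(\<lambda>n. indicator {0..u n} \<tau> *\<^sub>R (h (u n - \<tau>) * f \<tau>)) \<longlonglongrightarrow> h (a - \<tau>) * f \<tau>"
        proof (rule Lim_transform_eventually)
          show "eventually (\<lambda>n. h (u n - \<tau>) * f \<tau> = indicator {0..u n} \<tau> *\<^sub>R (h (u n - \<tau>) * f \<tau>)) sequentially"
            using ev by eventually_elim (use 2 in auto)
        qed
        then show ?thesis using 2 by simp
      next
        case 3
        have "eventually (\<lambda>n. u n < \<tau>) sequentially"
          using order_tendstoD(2)[OF ua] 3 by blast
        then have "eventually (\<lambda>n. indicator {0..u n} \<tau> *\<^sub>R (h (u n - \<tau>) * f \<tau>) = 0) sequentially"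
          by eventually_elim auto
        then show ?thesis using 3 by (simp add: tendsto_eventually)
      qed
    qed
  qed (use meas in auto)
qed

lemma primitive_has_vector_derivative:
  assumes f: "continuous_on {0..} f" and t: "0 \<le> t"
  shows "(primitive f has_vector_derivative f t) (at t within {0..})"
proof -
  have vc: "primitive f s = integral {0..s} f" for s
    unfolding volterra_conv_def
    using set_borel_integral_eq_integral(2)[OF half_line_integrableD[OF continuous_imp_half_line_integrable[OF f]], of s]
    by simp
  have "((\<lambda>s. integral {0..s} f) has_vector_derivative f t) (at t within {0..t+1})"
    using t by (intro integral_has_vector_derivative) (auto intro: continuous_on_subset[OF f])
  moreover have "at t within {0..t+1} = at t within {0..}"
    using t by (intro at_within_nhd[of _ "{..<t+1}"]) auto
  ultimately show ?thesis by (simp add: vc[abs_def])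
qed

lemma at_within_half_line_neq_bot:
  assumes "(0::real) \<le> t"
  shows "at t within {0..} \<noteq> bot"
proof -
  have "at t within {t<..} \<le> at t within {0..}"
    using assms by (intro at_le) auto
  then show ?thesis
    by (metis bot.extremum_uniqueI trivial_limit_at_right_real)
qed

text \<open>Division by \<open>\<one>\<close>: this is how integrations are removed
  again.\<close>

lemma primitive_cancel:
  assumes f: "continuous_on {0..} f" and g: "continuous_on {0..} g" 
    and eq: "\<And>t. 0 \<le> t \<Longrightarrow> primitive f t = primitive g t" and t: "0 \<le> t"
  shows "f t = g t"
proof -
  have "(primitive g has_vector_derivative f t) (at t within {0..})"
    using has_vector_derivative_transform[OF _ _ primitive_has_vector_derivative[OF f t], of "primitive g"] t eq
    by auto
  then show ?thesis
    using primitive_has_vector_derivative[OF g t] vector_derivative_within[OF at_within_half_line_neq_bot[OF t]]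
    by metis
qed

lemma half_line_integrable_one: "half_line_integrable (\<lambda>_. 1)"
  by (intro continuous_imp_half_line_integrable continuous_intros)

lemma continuous_on_primitive:
  "half_line_integrable f \<Longrightarrow> continuous_on {0..} (primitive f)"
  unfolding volterra_conv_commute[of "\<lambda>_. 1" f, abs_def] by (intro continuous_on_volterra_conv continuous_intros)

lemma primitive_of_derivative:
  assumes f: "continuous_on {0..} f" and d: "\<And>t. 0 \<le> t \<Longrightarrow> (F has_vector_derivative f t) (at t within {0..})"
    and t: "0 \<le> t"
  shows "primitive f t = F t - F 0"
proof -
  have "(f has_integral (F t - F 0)) {0..t}"
    using t d by (intro fundamental_theorem_of_calculus)
      (auto intro: has_vector_derivative_within_subset[OF d])
  moreover have "set_integrable lborel {0..t} f"
    by (rule half_line_integrableD[OF continuous_imp_half_line_integrable[OF f]])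
  ultimately show ?thesis
    by (simp add: volterra_conv_def set_borel_integral_eq_integral(2) integral_unique)
qed

section \<open>Laplace transform and its injectivity\<close>

definition laplace_integrable :: "(real \<Rightarrow> complex) \<Rightarrow> real \<Rightarrow> bool" where
  "laplace_integrable f s \<longleftrightarrow> set_integrable lborel {0..} (\<lambda>t. exp (- (s * t)) *\<^sub>R f t)"

definition laplace :: "(real \<Rightarrow> complex) \<Rightarrow> real \<Rightarrow> complex" where
  "laplace f s = (CLINT t:{0..}|lborel. exp (- (s * t)) *\<^sub>R f t)"

lemma laplace_volterra_conv:
  assumes "laplace_integrable f s" "laplace_integrable g s"
  shows "laplace_integrable (volterra_conv f g) s"
    and "laplace (volterra_conv f g) s = laplace f s * laplace g s"
proof -
  define F where "F t = indicator {0..} t *\<^sub>R exp (- (s * t)) *\<^sub>R f t" for t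
  define G where "G t = indicator {0..} t *\<^sub>R exp (- (s * t)) *\<^sub>R g t" for t
  have F: "integrable lborel F" and G: "integrable lborel G"
    using assms by (simp_all add: laplace_integrable_def set_integrable_def F_def[abs_def] G_def[abs_def])
  have conv: "(\<integral>\<tau>. F (t - \<tau>) * G \<tau> \<partial>lborel) = indicator {0..} t *\<^sub>R exp (- (s * t)) *\<^sub>R volterra_conv f g t" for t
  proof (cases "0 \<le> t")
    case True
    have "F (t - \<tau>) * G \<tau> = exp (- (s * t)) *\<^sub>R (indicator {0..t} \<tau> *\<^sub>R (f (t - \<tau>) * g \<tau>))" for \<tau>
    proof (cases "\<tau> \<in> {0..t}")
      case True
      have "exp (- (s * (t - \<tau>))) * exp (- (s * \<tau>)) = exp (- (s * t))"
        by (simp add: mult_exp_exp algebra_simps)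
      with True show ?thesis by (simp add: F_def G_def scaleR_conv_of_real mult_ac flip: of_real_mult)
    qed (auto simp: F_def G_def)
    then have "(\<integral>\<tau>. F (t - \<tau>) * G \<tau> \<partial>lborel) =
        exp (- (s * t)) *\<^sub>R (\<integral>\<tau>. indicator {0..t} \<tau> *\<^sub>R (f (t - \<tau>) * g \<tau>) \<partial>lborel)"
      by (simp only: integral_scaleR_right)
    then show ?thesis using True by (simp add: volterra_conv_def set_lebesgue_integral_def)
  next
    case False
    then have "F (t - \<tau>) * G \<tau> = 0" for \<tau> by (auto simp: F_def G_def indicator_def)
    then have "(\<integral>\<tau>. F (t - \<tau>) * G \<tau> \<partial>lborel) = 0" by (simp only: Bochner_Integration.integral_zero)
    then show ?thesis using False by simp
  qed
  note int = integrable_shear[OF F G]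
  have "integrable lborel (\<lambda>t. \<integral>\<tau>. F (t - \<tau>) * G \<tau> \<partial>lborel)"
    using lborel_pair.integrable_snd[OF int] by simp
  then show "laplace_integrable (volterra_conv f g) s"
    by (simp add: conv laplace_integrable_def set_integrable_def)
  have "laplace (volterra_conv f g) s = (\<integral>t. (\<integral>\<tau>. F (t - \<tau>) * G \<tau> \<partial>lborel) \<partial>lborel)"
    by (simp add: conv laplace_def set_lebesgue_integral_def)
  also have "\<dots> = (\<integral>\<tau>. (\<integral>t. F (t - \<tau>) * G \<tau> \<partial>lborel) \<partial>lborel)"
    by (rule lborel_pair.Fubini_integral[OF int])
  also have "\<dots> = (\<integral>\<tau>. (\<integral>t. F t \<partial>lborel) * G \<tau> \<partial>lborel)"
  proof (intro Bochner_Integration.integral_cong refl)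
    fix \<tau>
    have "(\<integral>t. F (t - \<tau>) \<partial>lborel) = (\<integral>t. F t \<partial>lborel)"
      using lborel_integral_real_affine[of 1 F "-\<tau>"] by (simp add: algebra_simps)
    then show "(\<integral>t. F (t - \<tau>) * G \<tau> \<partial>lborel) = (\<integral>t. F t \<partial>lborel) * G \<tau>" by simp
  qed
  also have "\<dots> = laplace f s * laplace g s"
    by (simp only: integral_mult_right_zero laplace_def set_lebesgue_integral_def F_def G_def)
  finally show "laplace (volterra_conv f g) s = laplace f s * laplace g s" .
qed

lemma laplace_add:
  assumes "laplace_integrable f s" "laplace_integrable g s"
  shows "laplace_integrable (\<lambda>t. f t + g t) s" "laplace (\<lambda>t. f t + g t) s = laplace f s + laplace g s"
  using set_integral_add[OF assms[unfolded laplace_integrable_def]]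
  by (simp_all add: laplace_integrable_def laplace_def scaleR_add_right)

lemma laplace_cmult:
  assumes "laplace_integrable f s"
  shows "laplace_integrable (\<lambda>t. c * f t) s" "laplace (\<lambda>t. c * f t) s = c * laplace f s"
  using assms by (simp_all add: laplace_integrable_def laplace_def flip: mult_scaleR_right)

lemma laplace_cong:
  assumes "\<And>t. 0 \<le> t \<Longrightarrow> f t = g t"
  shows "laplace_integrable f s = laplace_integrable g s" "laplace f s = laplace g s"
proof -
  have eq: "indicator {0..} t *\<^sub>R exp (- (s * t)) *\<^sub>R f t = indicator {0..} t *\<^sub>R exp (- (s * t)) *\<^sub>R g t" for t
    using assms by (auto simp: indicator_def)
  show "laplace_integrable f s = laplace_integrable g s" "laplace f s = laplace g s"
    unfolding laplace_integrable_def laplace_def set_integrable_def set_lebesgue_integral_def eq by simp_all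
qed

text \<open>The integral over \<open>{0..T}\<close> is explicit, and \<open>T\<close> tends to
  infinity.\<close>

lemma laplace_exp:
  assumes s: "s > 0"
  shows "laplace_integrable (\<lambda>t. exp (- \<i> * of_real \<omega> * of_real t)) s"
    and "laplace (\<lambda>t. exp (- \<i> * of_real \<omega> * of_real t)) s = 1 / (of_real s + \<i> * of_real \<omega>)"
proof -
  define p where "p = (of_real s + \<i> * of_real \<omega> :: complex)"
  have p0: "p \<noteq> 0" using s by (simp add: p_def complex_eq_iff)
  have normp: "norm (exp (- p * of_real t)) = exp (- (s * t))" for t
    by (simp add: norm_exp_eq_Re p_def)
  have eq: "exp (- (s * t)) *\<^sub>R exp (- \<i> * of_real \<omega> * of_real t) = exp (- p * of_real t)" for t
    by (simp add: p_def scaleR_conv_of_real exp_of_real[symmetric] mult_exp_exp algebra_simps)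
  have "(\<lambda>t. exp (- s * t)) absolutely_integrable_on {0..}"
    using has_integral_exp_minus_to_infinity[OF s, of 0]
    by (intro nonnegative_absolutely_integrable_1) (auto simp: has_integral_integrable)
  then have re: "set_integrable lborel {0..} (\<lambda>t. exp (- s * t))"
    unfolding set_integrable_def by (simp add: integrable_completion)
  have int: "set_integrable lborel {0..} (\<lambda>t. exp (- p * of_real t))"
  proof (rule set_integrable_bound[OF re])
    show "set_borel_measurable lborel {0..} (\<lambda>t. exp (- p * complex_of_real t))"
      unfolding set_borel_measurable_def by measurable
  qed (auto simp: norm_exp_eq_Re p_def)
  show "laplace_integrable (\<lambda>t. exp (- \<i> * of_real \<omega> * of_real t)) s"
    using int unfolding laplace_integrable_def eq .
  have "((\<lambda>T. CLINT t:{0..T}|lborel. exp (- p * of_real t)) \<longlongrightarrow> (CLINT t:{0..}|lborel. exp (- p * of_real t))) at_top"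
    by (rule tendsto_set_lebesgue_integral_at_top[OF _ int]) auto
  moreover have "eventually (\<lambda>T. (CLINT t:{0..T}|lborel. exp (- p * of_real t)) = (1 - exp (- p * of_real T)) / p) at_top"
    using eventually_ge_at_top[of 0]
  proof eventually_elim
    case (elim T)
    have "((\<lambda>t. exp (- p * of_real t)) has_integral (- exp (- p * of_real T) / p - - exp (- p * of_real 0) / p)) {0..T}"
      using elim p0
      by (intro fundamental_theorem_of_calculus)
         (auto intro!: derivative_eq_intros has_vector_derivative_real_field simp: field_simps)
    moreover have "set_integrable lborel {0..T} (\<lambda>t. exp (- p * of_real t))"
      by (rule set_integrable_subset[OF int]) auto
    ultimately show ?case
      using set_borel_integral_eq_integral(2) integral_unique by (metis (no_types, lifting) diff_divide_distrib
       minus_diff_eq minus_divide_left mult_zero_right of_real_0 exp_zero minus_minus diff_minus_eq_add add.commute uminus_add_conv_diff)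
  qed
  ultimately have "((\<lambda>T. (1 - exp (- p * of_real T)) / p) \<longlongrightarrow> (CLINT t:{0..}|lborel. exp (- p * of_real t))) at_top"
    by (rule Lim_transform_eventually)
  moreover have "((\<lambda>T. (1 - exp (- p * of_real T)) / p) \<longlongrightarrow> (1 - 0) / p) at_top"
  proof (intro tendsto_intros p0)
    have "((\<lambda>T. exp (- (s * T))) \<longlongrightarrow> 0) at_top"
      using s by (intro filterlim_compose[OF exp_at_bot] filterlim_uminus_at_top_at_bot[THEN filterlim_compose]
         filterlim_compose[OF filterlim_uminus_at_bot_at_top] filterlim_tendsto_pos_mult_at_top[OF tendsto_const _ filterlim_ident])
    then have "((\<lambda>T. norm (exp (- p * complex_of_real T))) \<longlongrightarrow> 0) at_top"
      by (simp only: normp)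
    then show "((\<lambda>T. exp (- p * complex_of_real T)) \<longlongrightarrow> 0) at_top"
      using tendsto_norm_zero_iff by blast
  qed
  ultimately have "(CLINT t:{0..}|lborel. exp (- p * of_real t)) = (1 - 0) / p"
    using tendsto_unique trivial_limit_at_top_linorder by blast
  then show "laplace (\<lambda>t. exp (- \<i> * of_real \<omega> * of_real t)) s = 1 / (of_real s + \<i> * of_real \<omega>)"
    unfolding laplace_def eq p_def by simp
qed

lemma laplace_one:
  assumes s: "s > 0"
  shows "laplace_integrable (\<lambda>_. 1) s" "laplace (\<lambda>_. 1) s = 1 / of_real s"
  using laplace_exp[OF s, of 0] by simp_all

text \<open>Under \<open>u = exp (- t)\<close> the hypothesis says that all moments of
  \<open>r\<close> on the unit interval vanish. By Weierstrass approximation so does the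
  integral of \<open>r\<close> against every continuous function of \<open>u\<close>, and one
  such function is \<open>r\<close> itself times a nonnegative cutoff. The cutoff keeps the test
  function continuous at \<open>u = 0\<close>, however fast \<open>r\<close> grows.\<close>

lemma lerch_real:
  fixes r :: "real \<Rightarrow> real"
  assumes cont: "continuous_on {0..} r"
    and int: "set_integrable lborel {0..} (\<lambda>t. exp (- t) * r t)"
    and zero: "\<And>n. (LINT t:{0..}|lborel. exp (- t) * r t * exp (- t) ^ n) = 0"
    and t: "0 \<le> t"
  shows "r t = 0"
proof -
  have test: "(LINT t:{0..}|lborel. exp (- t) * r t * g (exp (- t))) = 0"
    if g: "continuous_on UNIV g" for g :: "real \<Rightarrow> real"
  proof -
    define C where "C = (LINT t:{0..}|lborel. \<bar>exp (- t) * r t\<bar>)"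
    have "\<bar>LINT t:{0..}|lborel. exp (- t) * r t * g (exp (- t))\<bar> \<le> e * C" if e: "e > 0" for e
    proof -
      obtain p where p: "real_polynomial_function p" and pe: "\<And>u. u \<in> {0..1} \<Longrightarrow> \<bar>g u - p u\<bar> < e"
        using Stone_Weierstrass_real_polynomial_function[of "{0..1}" g e] e
          continuous_on_subset[OF g] by (metis compact_Icc top_greatest)
      obtain a n where pa: "p = (\<lambda>x. \<Sum>i\<le>n. a i * x ^ i)"
        using p unfolding real_polynomial_function_iff_sum by blast
      have gm [measurable]: "g \<in> borel_measurable borel" 
        using g by (rule borel_measurable_continuous_onI)
      have bnd: "set_integrable lborel {0..} (\<lambda>t. exp (- t) * r t * h (exp (- t)))"
        if hm: "h \<in> borel_measurable borel" and hb: "\<And>u. u \<in> {0..1} \<Longrightarrow> \<bar>h u\<bar> \<le> M" for h and M :: real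
        unfolding set_integrable_def
      proof (rule Bochner_Integration.integrable_bound)
        show "integrable lborel (\<lambda>x. M * (indicat_real {0..} x *\<^sub>R (exp (- x) * r x)))"
          using int unfolding set_integrable_def by (rule integrable_mult_right)
        have "(\<lambda>x. (indicat_real {0..} x *\<^sub>R (exp (- x) * r x)) * h (exp (- x))) \<in> borel_measurable lborel"
          using int hm unfolding set_integrable_def by (intro borel_measurable_times) auto
        then show "(\<lambda>x. indicat_real {0..} x *\<^sub>R (exp (- x) * r x * h (exp (- x)))) \<in> borel_measurable lborel"
          by (simp add: mult_ac)
        show "AE x in lborel. norm (indicat_real {0..} x *\<^sub>R (exp (- x) * r x * h (exp (- x))))
           \<le> norm (M * (indicat_real {0..} x *\<^sub>R (exp (- x) * r x)))"
        proof (intro AE_I2)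
          fix x :: real
          show "norm (indicat_real {0..} x *\<^sub>R (exp (- x) * r x * h (exp (- x))))
           \<le> norm (M * (indicat_real {0..} x *\<^sub>R (exp (- x) * r x)))"
          proof (cases "0 \<le> x")
            case True
            then have "\<bar>h (exp (-x))\<bar> \<le> \<bar>M\<bar>" using hb[of "exp (-x)"] by fastforce
            then have "\<bar>exp (- x) * r x\<bar> * \<bar>h (exp (-x))\<bar> \<le> \<bar>exp (- x) * r x\<bar> * \<bar>M\<bar>"
              by (intro mult_left_mono) auto
            then show ?thesis using True by (simp add: abs_mult mult_ac)
          qed simp
        qed
      qed
      have pm [measurable]: "p \<in> borel_measurable borel" unfolding pa by measurable
      have pint: "(LINT t:{0..}|lborel. exp (- t) * r t * p (exp (- t))) = 0"
      proof -
        have "set_integrable lborel {0..} (\<lambda>t. exp (- t) * r t * exp (- t) ^ i)" for i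
          by (rule bnd[of "\<lambda>u. u ^ i" 1]) (auto simp: power_le_one)
        then have *: "integrable lborel (\<lambda>t. indicator {0..} t *\<^sub>R (exp (- t) * r t * exp (- t) ^ i))" for i
          by (simp add: set_integrable_def)
        have "(LINT t:{0..}|lborel. exp (- t) * r t * p (exp (- t))) =
          (LINT t|lborel. (\<Sum>i\<le>n. a i * (indicator {0..} t *\<^sub>R (exp (- t) * r t * exp (- t) ^ i))))"
          unfolding set_lebesgue_integral_def pa
          by (intro Bochner_Integration.integral_cong) (auto simp: sum_distrib_left mult_ac)
        also have "\<dots> = (\<Sum>i\<le>n. a i * (LINT t:{0..}|lborel. exp (- t) * r t * exp (- t) ^ i))"
          using * by (simp add: set_lebesgue_integral_def)
        finally show ?thesis using zero by simp
      qed
      have i1: "set_integrable lborel {0..} (\<lambda>t. exp (- t) * r t * (g (exp (- t)) - p (exp (- t))))"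
        by (rule bnd[of "\<lambda>u. g u - p u" e]) (use pe in \<open>auto intro: less_imp_le\<close>)
      have "bounded (p ` {0..1})"
        using p by (intro compact_imp_bounded compact_continuous_image continuous_on_polymonial_function) (auto simp: real_polynomial_function_eq)
      then have "\<exists>M. \<forall>u\<in>{0..1}. \<bar>p u\<bar> \<le> M"
        unfolding bounded_iff by auto
      then obtain M where "\<And>u. u \<in> {0..1} \<Longrightarrow> \<bar>p u\<bar> \<le> M" by blast
      then have i2: "set_integrable lborel {0..} (\<lambda>t. exp (- t) * r t * p (exp (- t)))"
        by (intro bnd[of p]) auto
      have "(LINT t:{0..}|lborel. exp (- t) * r t * g (exp (- t))) =
         (LINT t:{0..}|lborel. exp (- t) * r t * (g (exp (- t)) - p (exp (- t))))"
        using set_integral_add(2)[OF i1 i2] pint by (simp add: algebra_simps)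
      also have "\<bar>\<dots>\<bar> \<le> (LINT t:{0..}|lborel. \<bar>exp (- t) * r t * (g (exp (- t)) - p (exp (- t)))\<bar>)"
        using set_integral_norm_bound[OF i1] by simp
      also have "\<dots> \<le> (LINT t:{0..}|lborel. e * \<bar>exp (- t) * r t\<bar>)"
      proof (rule set_integral_mono)
        show "set_integrable lborel {0..} (\<lambda>t. \<bar>exp (- t) * r t * (g (exp (- t)) - p (exp (- t)))\<bar>)"
          using i1 by (rule set_integrable_abs)
        show "set_integrable lborel {0..} (\<lambda>t. e * \<bar>exp (- t) * r t\<bar>)"
          using set_integrable_abs[OF int] by (rule set_integrable_mult_right)
        fix x :: real assume "x \<in> {0..}"
        then have "\<bar>g (exp (-x)) - p (exp (-x))\<bar> \<le> e" using pe[of "exp (-x)"] by auto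
        then have "\<bar>exp (- x) * r x\<bar> * \<bar>g (exp (-x)) - p (exp (-x))\<bar> \<le> \<bar>exp (- x) * r x\<bar> * e"
          by (intro mult_left_mono) auto
        then show "\<bar>exp (- x) * r x * (g (exp (- x)) - p (exp (- x)))\<bar> \<le> e * \<bar>exp (- x) * r x\<bar>"
          by (simp add: abs_mult mult_ac)
      qed
      also have "\<dots> = e * C" by (simp add: C_def)
      finally show ?thesis .
    qed
    note le = this
    have "C \<ge> 0" unfolding C_def set_lebesgue_integral_def by (intro Bochner_Integration.integral_nonneg) auto
    have "\<bar>LINT t:{0..}|lborel. exp (- t) * r t * g (exp (- t))\<bar> \<le> 0"
    proof (rule field_le_epsilon)
      fix e :: real assume e: "e > 0"
      have "e / (C + 1) * C \<le> e" using \<open>C \<ge> 0\<close> e by (simp add: field_simps)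
      then show "\<bar>LINT t:{0..}|lborel. exp (- t) * r t * g (exp (- t))\<bar> \<le> 0 + e"
        using le[of "e / (C + 1)"] e \<open>C \<ge> 0\<close> by simp
    qed
    then show ?thesis by simp
  qed
  define T where "T = t + 1"
  define g where "g u = r (- ln (min 1 (max u (exp (- T))))) * max 0 (u - exp (- T))" for u
  have m: "0 < min 1 (max u (exp (- T)))" for u :: real by (simp add: less_max_iff_disj)
  \<comment> \<open>clamping the argument of the logarithm makes \<open>g\<close> a total
    continuous function and leaves \<open>r (- ln u)\<close> intact at those \<open>u \<le>
    1\<close> where the last factor is positive\<close>
  have gc: "continuous_on UNIV g"
    unfolding g_def
  proof (intro continuous_intros continuous_on_compose2[OF cont])
    show "\<forall>x\<in>UNIV. min 1 (max x (exp (- T))) \<noteq> 0" using m by (metis less_irrefl)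
    show "(\<lambda>x. - ln (min 1 (max x (exp (- T))))) ` UNIV \<subseteq> {0..}"
      using m by (auto simp: ln_le_zero_iff)
  qed
  have gval: "exp (- s) * r s * g (exp (- s)) = (if s \<le> T then exp (- s) * (exp (- s) - exp (- T)) * (r s)\<^sup>2 else 0)"
    if "0 \<le> s" for s
  proof (cases "s \<le> T")
    case True
    then have "max (exp (- s)) (exp (- T)) = exp (- s)" "min 1 (exp (-s)) = exp (-s)" 
      using that by (auto simp: max_def min_def)
    then show ?thesis using True by (simp add: g_def power2_eq_square)
  qed (simp add: g_def)
  let ?h = "\<lambda>s. exp (- s) * (exp (- s) - exp (- T)) * (r s)\<^sup>2"
  have hc: "continuous_on {0..T} ?h"
    by (intro continuous_intros continuous_on_subset[OF cont]) auto
  have "0 = (LINT s:{0..}|lborel. exp (- s) * r s * g (exp (- s)))"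
    using test[OF gc] by simp
  also have "\<dots> = (LINT s:{0..T}|lborel. ?h s)"
    unfolding set_lebesgue_integral_def
  proof (intro Bochner_Integration.integral_cong refl)
    fix s :: real
    show "indicator {0..} s *\<^sub>R (exp (- s) * r s * g (exp (- s))) = indicator {0..T} s *\<^sub>R ?h s"
    proof (cases "0 \<le> s")
      case True
      show ?thesis unfolding gval[OF True] using True by (auto simp: indicator_def)
    qed auto
  qed
  also have "\<dots> = integral {0..T} ?h"
    by (intro set_borel_integral_eq_integral(2) borel_integrable_atLeastAtMost' hc)
  finally have "integral {0..T} ?h = 0" by simp
  then have "(?h has_integral 0) (cbox 0 T)"
    using integrable_continuous_interval[OF hc] by (metis box_real(2) integrable_integral)
  note int0 = this
  have "?h t = 0"
  proof (rule has_integral_0_cbox_imp_0[OF _ _ int0])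
    show "continuous_on (cbox 0 T) ?h" using hc by simp
    show "\<And>x. x \<in> box 0 T \<Longrightarrow> 0 \<le> ?h x" by auto
    show "t \<in> cbox 0 T" "box 0 T \<noteq> {}" using t by (auto simp: T_def)
  qed
  then show ?thesis by (simp add: T_def)
qed

text \<open>Lerch's theorem, for real and imaginary part separately; the values at positive
  integers \<open>s\<close> alone determine the function.\<close>

lemma laplace_eq_0_imp_eq_0:
  assumes cont: "continuous_on {0..} f" and int: "laplace_integrable f 1"
    and zero: "\<And>s. s > 0 \<Longrightarrow> laplace f s = 0" and t: "0 \<le> t"
  shows "f t = 0"
proof -
  have int': "set_integrable lborel {0..} (\<lambda>t. exp (- t) *\<^sub>R f t)"
    using int by (simp add: laplace_integrable_def)
  have zero': "(CLINT t:{0..}|lborel. (exp (- t) * exp (- t) ^ n) *\<^sub>R f t) = 0" for n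
    using zero[of "real (Suc n)"] 
    by (simp add: laplace_def exp_of_nat_mult[symmetric] mult_exp_exp algebra_simps)
  have intn: "integrable lborel (\<lambda>t. indicator {0..} t *\<^sub>R (exp (- t) * exp (- t) ^ n) *\<^sub>R f t)" for n
  proof (rule Bochner_Integration.integrable_bound[OF int'[unfolded set_integrable_def]])
    have "(\<lambda>t. exp (- t) ^ n *\<^sub>R (indicator {0..} t *\<^sub>R exp (- t) *\<^sub>R f t)) \<in> borel_measurable lborel"
      by (rule borel_measurable_scaleR[OF _ borel_measurable_integrable[OF int'[unfolded set_integrable_def]]]) measurable
    then show "(\<lambda>t. indicator {0..} t *\<^sub>R (exp (- t) * exp (- t) ^ n) *\<^sub>R f t) \<in> borel_measurable lborel"
      by (rule iffD1[OF measurable_cong, rotated]) (simp add: mult_ac)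
    have "exp (- t) ^ n * norm (f t) \<le> norm (f t)" if "t \<ge> 0" for t :: real
      using that by (intro mult_left_le_one_le) (auto simp: power_le_one)
    then show "AE x in lborel. norm (indicator {0..} x *\<^sub>R (exp (- x) * exp (- x) ^ n) *\<^sub>R f x)
          \<le> norm (indicator {0..} x *\<^sub>R exp (- x) *\<^sub>R f x)"
      by (intro AE_I2) (auto simp: indicator_def abs_mult mult.assoc)
  qed
  have "Re (f t) = 0"
  proof (rule lerch_real[OF _ _ _ t])
    show "continuous_on {0..} (\<lambda>t. Re (f t))" by (intro continuous_intros cont)
    show "set_integrable lborel {0..} (\<lambda>t. exp (- t) * Re (f t))"
      using integrable_Re[OF int'[unfolded set_integrable_def]] by (simp add: set_integrable_def mult.assoc)
    show "(LINT t:{0..}|lborel. exp (- t) * Re (f t) * exp (- t) ^ n) = 0" for n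
      using zero'[of n] integral_Re[OF intn[of n]] by (simp add: set_lebesgue_integral_def mult_ac)
  qed
  moreover have "Im (f t) = 0"
  proof (rule lerch_real[OF _ _ _ t])
    show "continuous_on {0..} (\<lambda>t. Im (f t))" by (intro continuous_intros cont)
    show "set_integrable lborel {0..} (\<lambda>t. exp (- t) * Im (f t))"
      using integrable_Im[OF int'[unfolded set_integrable_def]] by (simp add: set_integrable_def mult.assoc)
    show "(LINT t:{0..}|lborel. exp (- t) * Im (f t) * exp (- t) ^ n) = 0" for n
      using zero'[of n] integral_Im[OF intn[of n]] by (simp add: set_lebesgue_integral_def mult_ac)
  qed
  ultimately show ?thesis by (simp add: complex_eq_iff)
qed

section \<open>Smooth approximation of indicator functions\<close>

text \<open>The form in which the weight of \<^const>\<open>M1_plus\<close> is met below: a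
  quantity that is bounded, and \<open>O(1 / \<bar>\<omega>\<bar>)\<close> at infinity, is
  integrable.\<close>

lemma le_divide_sqrt_weight:
  fixes m a b \<omega> :: real
  assumes "0 \<le> m" "m \<le> a" "m * \<bar>\<omega>\<bar> \<le> b"
  shows "m \<le> (a + b) * (1 / sqrt (1 + \<omega>\<^sup>2))"
proof -
  have "sqrt (1 + \<omega>\<^sup>2) \<le> 1 + \<bar>\<omega>\<bar>"
    by (rule real_le_lsqrt) (auto simp: power2_eq_square algebra_simps)
  then have "m * sqrt (1 + \<omega>\<^sup>2) \<le> m * (1 + \<bar>\<omega>\<bar>)"
    using assms(1) by (rule mult_left_mono)
  also have "\<dots> \<le> a + b" using assms by (simp add: algebra_simps)
  finally show ?thesis by (simp add: pos_le_divide_eq add_pos_nonneg)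
qed

lemma smooth_of_derivative_sequence:
  assumes "\<And>n t. (g n has_vector_derivative g (Suc n) t) (at t)"
  shows "smooth (g 0)"
proof -
  have "((\<lambda>f s. vector_derivative f (at s)) ^^ n) (g 0) = g n" for n
  proof (induction n)
    case (Suc n)
    then show ?case using vector_derivative_at[OF assms[of n]] by auto
  qed simp
  then show ?thesis
    unfolding smooth_def using assms differentiableI_vector by metis
qed

text \<open>The functions \<open>p q\<^bsup>-m\<^esup> exp (- 1 / q)\<close> with \<open>q = x
  (1 - x)\<close> and \<open>p\<close> a polynomial, extended by zero. This family is closed
  under differentiation, so all its members are smooth, and it contains the standard bump
  function.\<close>

definition bump_term :: "real poly \<Rightarrow> nat \<Rightarrow> real \<Rightarrow> real" where
  "bump_term p m x =
    (if 0 < x \<and> x < 1 then poly p x / (x * (1 - x)) ^ m * exp (- (1 / (x * (1 - x)))) else 0)"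

text \<open>From \<open>exp u \<ge> u\<^bsup>m+2\<^esup> / (m+2)!\<close> at \<open>u = 1 /
  q\<close>: the exponential beats the pole and leaves two powers of \<open>q\<close>, which
  makes the derivative vanish at the end points.\<close>

lemma bump_term_bound:
  obtains C where "\<And>x. \<bar>bump_term p m x\<bar> \<le> C * (x * (1 - x))\<^sup>2"
proof -
  have "bounded (poly p ` {0..1})"
    by (intro compact_imp_bounded compact_continuous_image continuous_intros) auto
  then have "\<exists>P. \<forall>x\<in>{0..1}. \<bar>poly p x\<bar> \<le> P"
    unfolding bounded_iff by auto
  then obtain P where P: "\<And>x. x \<in> {0..1} \<Longrightarrow> \<bar>poly p x\<bar> \<le> P" by blast
  have P0: "0 \<le> P" using P[of 0] by simp
  have "\<bar>bump_term p m x\<bar> \<le> (P * fact (m + 2)) * (x * (1 - x))\<^sup>2" for x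
  proof (cases "0 < x \<and> x < 1")
    case True
    define q where "q = x * (1 - x)"
    have q: "q > 0" using True by (simp add: q_def)
    define c where "c = (fact (m + 2) :: real)"
    have c: "c > 0" by (simp add: c_def)
    have "(\<Sum>k\<in>{m+2}. (1 / q) ^ k /\<^sub>R fact k) \<le> exp (1 / q)"
      unfolding exp_def using q summable_exp_generic[of "1 / q"]
      by (intro sum_le_suminf) auto
    then have "(1 / q) ^ (m + 2) / c \<le> exp (1 / q)"
      by (simp only: c_def sum.insert finite.emptyI empty_iff not_False_eq_True sum.empty) (simp add: divide_inverse mult_ac)
    then have "inverse (exp (1 / q)) \<le> inverse ((1 / q) ^ (m + 2) / c)"
      using c q by (intro le_imp_inverse_le) auto
    then have "exp (- (1 / q)) \<le> c * q ^ (m + 2)"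
      using q c by (simp only: exp_minus) (simp add: field_simps)
    then have "exp (- (1 / q)) / q ^ m \<le> fact (m + 2) * q\<^sup>2"
      unfolding c_def[symmetric] using q by (simp add: pos_divide_le_eq power2_eq_square mult_ac)
    then have "\<bar>poly p x\<bar> * (exp (- (1 / q)) / q ^ m) \<le> P * (fact (m + 2) * q\<^sup>2)"
      using q True P0 by (intro mult_mono P) auto
    then show ?thesis using True q by (simp add: bump_term_def abs_mult flip: q_def)
  qed (use P0 in \<open>auto simp: bump_term_def\<close>)
  then show ?thesis using that by blast
qed

lemma has_real_derivative_zero_of_quadratic_bound:
  fixes f :: "real \<Rightarrow> real"
  assumes "f x = 0" "\<And>y. \<bar>f y\<bar> \<le> C * (y - x)\<^sup>2"
  shows "(f has_real_derivative 0) (at x)"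
proof -
  have "((\<lambda>y. (f y - f x) / (y - x)) \<longlongrightarrow> 0) (at x)"
  proof (rule Lim_null_comparison)
    show "eventually (\<lambda>y. norm ((f y - f x) / (y - x)) \<le> C * \<bar>y - x\<bar>) (at x)"
      unfolding eventually_at_filter
      using assms by (intro always_eventually allI impI)
        (simp add: divide_simps power2_eq_square abs_mult[symmetric] mult.assoc)
    show "((\<lambda>y. C * \<bar>y - x\<bar>) \<longlongrightarrow> 0) (at x)"
      by (auto intro!: tendsto_eq_intros)
  qed
  then show ?thesis by (simp add: has_field_derivative_iff)
qed

definition bump_poly_deriv :: "real poly \<Rightarrow> nat \<Rightarrow> real poly" where
  "bump_poly_deriv p m = (let q = [:0, 1, -1:] in
     pderiv p * q ^ 2 - of_nat m * p * pderiv q * q + p * pderiv q)"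

lemma bump_term_deriv:
  "(bump_term p m has_real_derivative bump_term (bump_poly_deriv p m) (m + 2) x) (at x)"
proof (cases "0 < x \<and> x < 1")
  case True
  define q where "q = x * (1 - x)"
  have q: "q > 0" using True by (simp add: q_def)
  have dq: "((\<lambda>x. x * (1 - x)) has_real_derivative (1 - 2 * x)) (at x)"
    by (auto intro!: derivative_eq_intros)
  have d1: "((\<lambda>x. poly p x / (x * (1 - x)) ^ m) has_real_derivative
      (poly (pderiv p) x * q ^ m - poly p x * (of_nat m * q ^ (m - 1) * (1 - 2 * x))) / (q ^ m * q ^ m)) (at x)"
    using DERIV_divide[OF poly_DERIV[of p x] DERIV_power[OF dq, of m]] True
    by (auto simp: q_def mult_ac)
  have d2: "((\<lambda>x. exp (- (1 / (x * (1 - x))))) has_real_derivative exp (- (1 / q)) * ((1 - 2 * x) / q\<^sup>2)) (at x)"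
    by (rule DERIV_cong[OF DERIV_fun_exp[OF DERIV_minus[OF DERIV_divide[OF DERIV_const[of 1] dq]]]])
      (use True in \<open>auto simp: q_def power2_eq_square divide_simps algebra_simps\<close>)
  have "((\<lambda>x. poly p x / (x * (1 - x)) ^ m * exp (- (1 / (x * (1 - x))))) has_real_derivative
      (poly (pderiv p) x * q ^ m - poly p x * (of_nat m * q ^ (m - 1) * (1 - 2 * x))) / (q ^ m * q ^ m) * exp (- (1 / q))
       + poly p x / q ^ m * (exp (- (1 / q)) * ((1 - 2 * x) / q\<^sup>2))) (at x)"
    using DERIV_mult[OF d1 d2] by (simp add: q_def[symmetric] mult_ac add.commute)
  also have "(poly (pderiv p) x * q ^ m - poly p x * (of_nat m * q ^ (m - 1) * (1 - 2 * x))) / (q ^ m * q ^ m) * exp (- (1 / q))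
       + poly p x / q ^ m * (exp (- (1 / q)) * ((1 - 2 * x) / q\<^sup>2))
    = (poly (pderiv p) x * q ^ 2 - of_nat m * poly p x * (1 - 2 * x) * q + poly p x * (1 - 2 * x)) / q ^ (m + 2) * exp (- (1 / q))"
    using q by (cases m) (simp_all add: field_simps power2_eq_square)
  also have "\<dots> = bump_term (bump_poly_deriv p m) (m + 2) x"
    using True by (simp add: bump_term_def bump_poly_deriv_def Let_def pderiv_pCons q_def algebra_simps)
  finally show ?thesis
  proof (rule has_field_derivative_transform_within_open)
    show "open {0<..<1::real}" "x \<in> {0<..<1}" using True by auto
  qed (auto simp: bump_term_def)
next
  case False
  obtain C where C: "\<And>y. \<bar>bump_term p m y\<bar> \<le> C * (y * (1 - y))\<^sup>2"
    using bump_term_bound by blast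
  have C0: "0 \<le> C"
    using order_trans[OF abs_ge_zero C[of "1/2"]] by (simp add: zero_le_mult_iff)
  have "\<bar>bump_term p m y\<bar> \<le> C * (y - x)\<^sup>2" for y
  proof (cases "0 < y \<and> y < 1")
    case True
    have "y * (1 - y) \<le> y" "y * (1 - y) \<le> 1 - y"
      using True by (simp_all add: mult_le_cancel_left1 mult_le_cancel_right1)
    moreover have "y \<le> \<bar>y - x\<bar> \<or> 1 - y \<le> \<bar>y - x\<bar>"
      using False by (auto simp: abs_if)
    ultimately have "y * (1 - y) \<le> \<bar>y - x\<bar>" by (metis order_trans)
    then have "(y * (1 - y))\<^sup>2 \<le> \<bar>y - x\<bar>\<^sup>2"
      using True by (intro power_mono) auto
    then have "C * (y * (1 - y))\<^sup>2 \<le> C * (y - x)\<^sup>2"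
      using C0 by (intro mult_left_mono) auto
    then show ?thesis using C[of y] by linarith
  qed (use C0 in \<open>auto simp: bump_term_def\<close>)
  moreover have "bump_term p m x = 0" "bump_term (bump_poly_deriv p m) (m + 2) x = 0"
    using False by (auto simp: bump_term_def)
  ultimately show ?thesis
    using has_real_derivative_zero_of_quadratic_bound by metis
qed

text \<open>The normalised integral of the bump function, together with all its
  derivatives.\<close>

lemma smooth_step_exists:
  obtains g :: "nat \<Rightarrow> real \<Rightarrow> real" where
    "\<And>n t. (g n has_real_derivative g (Suc n) t) (at t)"
    "\<And>t. t \<le> 0 \<Longrightarrow> g 0 t = 0" "\<And>t. 1 \<le> t \<Longrightarrow> g 0 t = 1" "\<And>t. 0 \<le> g 1 t"
proof -
  define P where "P = rec_nat ([:1:], 0) (\<lambda>n (p, m). (bump_poly_deriv p m, m + 2))"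
  define b where "b n = bump_term (fst (P n)) (snd (P n))" for n
  have db: "(b n has_real_derivative b (Suc n) t) (at t)" for n t
    unfolding b_def P_def by (simp add: bump_term_deriv[of _ "m" for m, simplified] case_prod_beta)
  have b0: "b 0 = bump_term [:1:] 0" by (simp add: b_def P_def)
  have bc: "continuous_on S (b 0)" for S
    using db by (meson DERIV_isCont continuous_at_imp_continuous_on)
  have bi: "b 0 integrable_on {u..v}" for u v
    using bc by (rule integrable_continuous_interval)
  have bn: "0 \<le> b 0 t" for t by (simp add: b0 bump_term_def)
  define c where "c = integral {0..1} (b 0)"
  have "c \<noteq> 0"
  proof
    assume "c = 0"
    then have "(b 0 has_integral 0) (cbox 0 1)"
      using bi[of 0 1] by (simp add: c_def has_integral_iff)
    then have "b 0 (1/2) = 0"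
      using bc bn by (intro has_integral_0_cbox_imp_0[of 0 1]) auto
    then show False by (simp add: b0 bump_term_def)
  qed
  moreover have "c \<ge> 0" unfolding c_def using bn bi by (intro Henstock_Kurzweil_Integration.integral_nonneg) auto
  ultimately have c: "c > 0" by simp
  define Psi where "Psi t = (if t \<le> 0 then 0 else integral {0..t} (b 0))" for t
  have Psi_eq: "Psi t = integral {-1..t} (b 0)" for t
  proof (cases "t \<le> 0")
    case True
    have "integral {-1..t} (b 0) = integral {-1..t} (\<lambda>_::real. 0)"
      by (rule Henstock_Kurzweil_Integration.integral_cong) (use True in \<open>auto simp: b0 bump_term_def\<close>)
    then show ?thesis using True by (simp add: Psi_def)
  next
    case False
    have "integral {-1..0} (b 0) = integral {-1..0} (\<lambda>_::real. 0)"
      by (rule Henstock_Kurzweil_Integration.integral_cong) (auto simp: b0 bump_term_def)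
    then show ?thesis
      using False Henstock_Kurzweil_Integration.integral_combine[of "-1" 0 t "b 0"] bi by (simp add: Psi_def)
  qed
  have dPsi: "(Psi has_real_derivative b 0 t) (at t)" for t
  proof (cases "-1 < t")
    case True
    have "((\<lambda>s. integral {-1..s} (b 0)) has_real_derivative b 0 t) (at t within {-1..t+1})"
      using True by (intro integral_has_real_derivative bc) auto
    moreover have "at t within {-1..t+1} = at t"
      using True by (intro at_within_interior) auto
    ultimately show ?thesis by (simp add: Psi_eq[abs_def])
  next
    case False
    have "((\<lambda>s. 0) has_real_derivative 0) (at t)" by simp
    then have "(Psi has_real_derivative 0) (at t)"
      by (rule has_field_derivative_transform_within_open[of _ _ _ "{..<0}"])
         (use False in \<open>auto simp: Psi_def\<close>)
    then show ?thesis using False by (simp add: b0 bump_term_def)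
  qed
  define g where "g n t = (case n of 0 \<Rightarrow> Psi t | Suc k \<Rightarrow> b k t) / c" for n t
  show ?thesis
  proof
    show "(g n has_real_derivative g (Suc n) t) (at t)" for n t
      unfolding g_def using db dPsi by (cases n) (auto intro!: DERIV_cdivide)
    show "g 0 t = 0" if "t \<le> 0" for t using that by (simp add: g_def Psi_def)
    show "g 0 t = 1" if "1 \<le> t" for t
    proof -
      have "integral {1..t} (b 0) = integral {1..t} (\<lambda>_::real. 0)"
        by (rule Henstock_Kurzweil_Integration.integral_cong) (auto simp: b0 bump_term_def)
      then have "integral {0..t} (b 0) = c"
        using that Henstock_Kurzweil_Integration.integral_combine[of 0 1 t "b 0"] bi by (simp add: c_def)
      then show ?thesis using that c by (simp add: g_def Psi_def)
    qed
    show "0 \<le> g 1 t" for t using bn c by (simp add: g_def)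
  qed
qed

text \<open>Differences \<open>\<Psi> (n s) - \<Psi> (n (s - t))\<close> of rescaled smooth
  steps \<open>\<Psi>\<close>. Their total variation is at most \<open>2\<close> for every
  \<open>n\<close>; after an integration by parts this bounds
  \<open>\<bar>\<omega>\<bar>\<close> times the Fourier transform uniformly in \<open>n\<close>,
  which gives a bound that a measure in \<^const>\<open>M1_plus\<close> can integrate.\<close>

lemma smooth_indicator_approximation:
  fixes t :: real
  assumes t: "0 \<le> t"
  obtains \<phi> :: "nat \<Rightarrow> real \<Rightarrow> complex" where
    "\<And>n. test_function (\<phi> n)" "\<And>n. continuous_on UNIV (\<phi> n)"
    "\<And>n s. norm (\<phi> n s) \<le> indicator {0..t+1} s"
    "\<And>s. (\<lambda>n. \<phi> n s) \<longlonglongrightarrow> indicator {0<..t} s"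
    "\<And>n \<omega>. norm (fourier (\<phi> n) \<omega>) \<le> (t + 3) * (1 / sqrt (1 + \<omega>\<^sup>2))"
proof -
  obtain g :: "nat \<Rightarrow> real \<Rightarrow> real" where
    dg: "\<And>n t. (g n has_real_derivative g (Suc n) t) (at t)" and
    g0: "\<And>t. t \<le> 0 \<Longrightarrow> g 0 t = 0" and g1: "\<And>t. 1 \<le> t \<Longrightarrow> g 0 t = 1" and pos: "\<And>t. 0 \<le> g 1 t"
    using smooth_step_exists by blast
  have mono: "g 0 a \<le> g 0 b" if "a \<le> b" for a b
    using that by (rule DERIV_nonneg_imp_nondecreasing) (use dg[of 0] pos in auto)
  define \<phi>' :: "nat \<Rightarrow> nat \<Rightarrow> real \<Rightarrow> real" where
    "\<phi>' m n s = real (Suc n) ^ m * (g m (real (Suc n) * s) - g m (real (Suc n) * (s - t)))" for m n s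
  define \<phi> :: "nat \<Rightarrow> real \<Rightarrow> complex" where "\<phi> n s = of_real (\<phi>' 0 n s)" for n s
  have d: "(\<phi>' m n has_real_derivative \<phi>' (Suc m) n s) (at s)" for m n s
    unfolding \<phi>'_def by (auto intro!: derivative_eq_intros DERIV_chain2[OF dg] simp: algebra_simps)
  have dc: "((\<lambda>s. of_real (\<phi>' m n s) :: complex) has_vector_derivative of_real (\<phi>' (Suc m) n s)) (at s)" for m n s
    using d by (intro has_vector_derivative_of_real) (simp add: has_real_derivative_iff_has_vector_derivative)
  have range: "0 \<le> \<phi>' 0 n s" "\<phi>' 0 n s \<le> 1" for n s
  proof -
    have "g 0 (real (Suc n) * (s - t)) \<le> g 0 (real (Suc n) * s)"
      using t by (intro mono mult_left_mono) auto
    moreover have "0 \<le> g 0 u" "g 0 u \<le> 1" for u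
      using mono[of "min u 0" u] g0[of "min u 0"] mono[of u "max u 1"] g1[of "max u 1"] by auto
    ultimately show "0 \<le> \<phi>' 0 n s" "\<phi>' 0 n s \<le> 1"
      unfolding \<phi>'_def by (auto, smt (verit))
  qed
  have zero: "\<phi>' 0 n s = 0" if "s \<le> 0 \<or> t + 1 \<le> s" for n s
  proof (cases "s \<le> 0")
    case True
    then have "real (Suc n) * s \<le> 0" "real (Suc n) * (s - t) \<le> 0"
      using t by (auto intro!: mult_nonneg_nonpos)
    then show ?thesis by (simp add: \<phi>'_def g0 del: of_nat_Suc)
  next
    case False
    then have s: "1 \<le> s - t" "1 \<le> s" using that t by auto
    have "1 * 1 \<le> real (Suc n) * s" "1 * 1 \<le> real (Suc n) * (s - t)"
      using s by (intro mult_mono; simp)+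
    then show ?thesis by (simp add: \<phi>'_def g1 del: of_nat_Suc)
  qed
  have cont: "continuous_on S (\<phi>' m n)" for S m n
    using d by (meson DERIV_isCont continuous_at_imp_continuous_on)
  have contc: "continuous_on S (\<phi> n)" for S n
    unfolding \<phi>_def[abs_def] by (intro continuous_intros cont)
  have bnd: "norm (\<phi> n s) \<le> indicator {0..t+1} s" for n s
    using range[of n s] zero[of s n] by (auto simp: \<phi>_def indicator_def)
  show ?thesis
  proof
    show "continuous_on UNIV (\<phi> n)" for n by (rule contc)
    show "norm (\<phi> n s) \<le> indicator {0..t+1} s" for n s by (rule bnd)
    show "test_function (\<phi> n)" for n
      unfolding test_function_def
    proof
      show "smooth (\<phi> n)"
        using smooth_of_derivative_sequence[of "\<lambda>m s. of_real (\<phi>' m n s)"] dc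
        by (simp add: \<phi>_def[abs_def])
      show "\<exists>R. \<forall>s. \<bar>s\<bar> > R \<longrightarrow> \<phi> n s = 0"
        using t by (intro exI[of _ "t + 1"]) (auto simp: \<phi>_def intro!: zero)
    qed
    show "(\<lambda>n. \<phi> n s) \<longlonglongrightarrow> indicator {0<..t} s" for s
    proof -
      have large: "eventually (\<lambda>n. 1 \<le> real (Suc n) * u) sequentially" if "u > 0" for u :: real
      proof -
        have "eventually (\<lambda>n. n \<ge> nat \<lceil>1 / u\<rceil>) sequentially" by (rule eventually_ge_at_top)
        then show ?thesis
        proof eventually_elim
          case (elim n)
          then have "1 / u \<le> real (Suc n)" by linarith
          then show ?case using that by (simp add: field_simps)
        qed
      qed
      have "eventually (\<lambda>n. \<phi>' 0 n s = indicator {0<..t} s) sequentially"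
      proof (cases "s \<le> 0")
        case True
        then show ?thesis by (simp add: zero)
      next
        case False
        then have "0 < s" by simp
        show ?thesis
        proof (cases "s \<le> t")
          case True
          then have "real (Suc n) * (s - t) \<le> 0" for n by (intro mult_nonneg_nonpos) auto
          then have 0: "g 0 (real (Suc n) * (s - t)) = 0" for n by (rule g0)
          show ?thesis using large[OF \<open>0 < s\<close>]
            by eventually_elim (use True \<open>0 < s\<close> in \<open>simp add: \<phi>'_def 0 g1 del: of_nat_Suc\<close>)
        next
          case False
          then have "0 < s - t" by simp
          show ?thesis using large[OF \<open>0 < s\<close>] large[OF \<open>0 < s - t\<close>]
            by eventually_elim (use False in \<open>simp add: \<phi>'_def g1 del: of_nat_Suc\<close>)
        qed
      qed
      then have "eventually (\<lambda>n. \<phi> n s = indicator {0<..t} s) sequentially"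
        by eventually_elim (simp add: \<phi>_def indicator_def)
      then show ?thesis by (rule tendsto_eventually)
    qed
    show "norm (fourier (\<phi> n) \<omega>) \<le> (t + 3) * (1 / sqrt (1 + \<omega>\<^sup>2))" for n \<omega>
    proof -
      define e where "e s = exp (- \<i> * of_real \<omega> * of_real s)" for s :: real
      have norm_e: "norm (e s) = 1" for s by (simp add: e_def norm_exp_eq_Re)
      have ce: "continuous_on S e" for S unfolding e_def by (intro continuous_intros)
      have de: "(e has_vector_derivative (- \<i> * of_real \<omega>) * e s) (at s)" for s
        unfolding e_def by (auto intro!: derivative_eq_intros has_vector_derivative_real_field)
      let ?I = "{-1..t+2}"
      have ei: "(\<lambda>s. e s * \<phi> n s) integrable_on ?I"
        by (intro integrable_continuous_interval continuous_intros ce contc)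
      have "fourier (\<phi> n) \<omega> = (CLINT s:?I|lborel. e s * \<phi> n s)"
        unfolding fourier_def set_lebesgue_integral_def e_def
        by (intro Bochner_Integration.integral_cong) (auto simp: indicator_def \<phi>_def zero)
      also have "\<dots> = integral ?I (\<lambda>s. e s * \<phi> n s)"
        by (intro set_borel_integral_eq_integral(2) borel_integrable_atLeastAtMost' continuous_intros ce contc)
      finally have F: "fourier (\<phi> n) \<omega> = integral ?I (\<lambda>s. e s * \<phi> n s)" .
      have 1: "norm (fourier (\<phi> n) \<omega>) \<le> t + 1"
      proof -
        have "((\<lambda>s. if s \<in> {0..t+1} then 1 else 0 :: real) has_integral (t + 1)) ?I"
          using has_integral_const_real[of "1::real" 0 "t + 1"] t
          by (subst has_integral_restrict) auto
        also have "(\<lambda>s. if s \<in> {0..t+1} then 1 else 0 :: real) = indicator {0..t+1}"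
          by (auto simp: indicator_def)
        finally have ind: "((indicator {0..t+1} :: real \<Rightarrow> real) has_integral (t + 1)) ?I" .
        have "norm (integral ?I (\<lambda>s. e s * \<phi> n s)) \<le> integral ?I (indicator {0..t+1})"
          using ei ind bnd[of n]
          by (intro integral_norm_bound_integral) (auto simp: norm_mult norm_e has_integral_integrable)
        then show ?thesis using ind by (simp add: F integral_unique)
      qed
      have 2: "norm (fourier (\<phi> n) \<omega>) * \<bar>\<omega>\<bar> \<le> 2"
      proof -
        have "((\<lambda>s. e s * of_real (\<phi>' 1 n s) + (- \<i> * of_real \<omega>) * e s * \<phi> n s) has_integral
            (e (t+2) * \<phi> n (t+2) - e (-1) * \<phi> n (-1))) ?I"
          using t
        proof (intro fundamental_theorem_of_calculus)
          fix s
          show "((\<lambda>s. e s * \<phi> n s) has_vector_derivative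
              e s * of_real (\<phi>' 1 n s) + (- \<i> * of_real \<omega>) * e s * \<phi> n s) (at s within ?I)"
            using has_vector_derivative_mult[OF de[of s] dc[of 0 n s], THEN has_vector_derivative_at_within]
            unfolding \<phi>_def One_nat_def .
        qed auto
        moreover have "\<phi> n (t+2) = 0" "\<phi> n (-1) = 0" by (auto simp: \<phi>_def zero)
        ultimately have h1: "((\<lambda>s. e s * of_real (\<phi>' 1 n s) + (- \<i> * of_real \<omega>) * e s * \<phi> n s) has_integral 0) ?I"
          by simp
        \<comment> \<open>the integration by parts: the total derivative integrates to zero, so
          both of its terms have the same integral up to sign\<close>
        have h2: "((\<lambda>s. (- \<i> * of_real \<omega>) * (e s * \<phi> n s)) has_integral (- \<i> * of_real \<omega>) * fourier (\<phi> n) \<omega>) ?I"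
          unfolding F by (intro has_integral_mult_right integrable_integral ei)
        have "((\<lambda>s. e s * of_real (\<phi>' 1 n s)) has_integral (0 - (- \<i> * of_real \<omega>) * fourier (\<phi> n) \<omega>)) ?I"
          using has_integral_diff[OF h1 h2] by (simp add: mult_ac)
        then have h3: "((\<lambda>s. e s * of_real (\<phi>' 1 n s)) has_integral (\<i> * of_real \<omega> * fourier (\<phi> n) \<omega>)) ?I"
          by simp
        \<comment> \<open>\<open>h'\<close> dominates the modulus of the derivative of
          \<open>\<phi> n\<close>, and its integral is the increment of \<open>h\<close>, a sum
          of two monotone steps from \<open>0\<close> to \<open>1\<close>\<close>
        define h where "h s = g 0 (real (Suc n) * s) + g 0 (real (Suc n) * (s - t))" for s
        define h' where "h' s = real (Suc n) * (g 1 (real (Suc n) * s) + g 1 (real (Suc n) * (s - t)))" for s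
        have h4: "(h' has_integral (h (t+2) - h (-1))) ?I"
        proof (rule fundamental_theorem_of_calculus)
          fix s
          have "(h has_real_derivative h' s) (at s)"
            unfolding h_def h'_def by (auto intro!: derivative_eq_intros DERIV_chain2[OF dg] simp: algebra_simps)
          then show "(h has_vector_derivative h' s) (at s within ?I)"
            by (simp add: has_real_derivative_iff_has_vector_derivative has_vector_derivative_at_within)
        qed (use t in auto)
        have "h (t+2) - h (-1) \<le> 2"
        proof -
          have "0 \<le> g 0 u" "g 0 u \<le> 1" for u
            using mono[of "min u 0" u] g0[of "min u 0"] mono[of u "max u 1"] g1[of "max u 1"] by auto
          then show ?thesis unfolding h_def by (smt (verit))
        qed
        moreover have "norm (\<i> * of_real \<omega> * fourier (\<phi> n) \<omega>) \<le> h (t+2) - h (-1)"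
        proof -
          have "norm (e s * of_real (\<phi>' 1 n s)) \<le> h' s" for s
          proof -
            have "\<bar>g 1 u - g 1 w\<bar> \<le> g 1 u + g 1 w" for u w using pos[of u] pos[of w] by linarith
            then have "real (Suc n) * \<bar>g 1 (real (Suc n) * s) - g 1 (real (Suc n) * (s - t))\<bar> \<le> h' s"
              unfolding h'_def by (rule mult_left_mono) simp
            then show ?thesis by (simp add: norm_mult norm_e \<phi>'_def abs_mult del: of_nat_Suc of_real_mult of_real_diff)
          qed
          then have "norm (integral ?I (\<lambda>s. e s * of_real (\<phi>' 1 n s))) \<le> integral ?I h'"
            using h3 h4 by (intro integral_norm_bound_integral) (auto simp: has_integral_integrable)
          then show ?thesis using h3 h4 by (simp add: integral_unique)
        qed
        ultimately show ?thesis by (simp add: norm_mult mult.commute)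
      qed
      show ?thesis using le_divide_sqrt_weight[OF norm_ge_zero 1 2] by (simp add: add.commute add.assoc)
    qed
  qed
qed

section \<open>Primitives of Fourier transforms of measures\<close>

lemma M1_plusD:
  assumes "lam \<in> M1_plus"
  shows "sets lam = sets borel" "space lam = UNIV" "integrable lam (\<lambda>s. 1 / sqrt (1 + s\<^sup>2))"
    "sigma_finite_measure lam"
proof -
  have lf: "locally_finite_borel lam" and fin: "(\<integral>\<^sup>+ s. ennreal ((1 + s\<^sup>2) powr (- 1 / 2)) \<partial>lam) < \<infinity>"
    using assms by (auto simp: M1_plus_def)
  show sets: "sets lam = sets borel" using lf by (simp add: locally_finite_borel_def)
  then show sp: "space lam = UNIV" by (metis sets_eq_imp_space_eq space_borel)
  note [measurable_cong] = sets
  have eq: "(1 + s\<^sup>2) powr (- 1 / 2) = 1 / sqrt (1 + s\<^sup>2)" for s :: real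
    by (simp add: powr_minus powr_half_sqrt inverse_eq_divide minus_divide_left[symmetric] add_nonneg_nonneg)
  show "integrable lam (\<lambda>s. 1 / sqrt (1 + s\<^sup>2))"
  proof (rule integrableI_bounded)
    show "(\<integral>\<^sup>+ x. ennreal (norm (1 / sqrt (1 + x\<^sup>2))) \<partial>lam) < \<infinity>"
      using fin unfolding eq by simp
  qed measurable
  show "sigma_finite_measure lam"
  proof
    show "\<exists>A. countable A \<and> A \<subseteq> sets lam \<and> \<Union> A = space lam \<and> (\<forall>a\<in>A. emeasure lam a \<noteq> \<infinity>)"
    proof (intro exI[of _ "range (\<lambda>n. {- real n..real n})"] conjI ballI)
      show "\<Union> (range (\<lambda>n. {- real n..real n})) = space lam"
      proof -
        have "\<exists>n. x \<in> {- real n..real n}" for x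
          using real_arch_simple[of "\<bar>x\<bar>"] by (auto simp: abs_le_iff minus_le_iff)
        then show ?thesis by (auto simp: sp)
      qed
      fix a assume "a \<in> range (\<lambda>n. {- real n..real n})"
      then have "compact a" by auto
      then have "emeasure lam a < \<infinity>" using lf by (simp add: locally_finite_borel_def)
      then show "emeasure lam a \<noteq> \<infinity>" by auto
    qed (auto simp: sets)
  qed
qed

text \<open>The primitive of \<open>exp (- i \<omega> \<cdot>)\<close> in closed form, which
  makes joint measurability evident.\<close>

definition exp_primitive :: "real \<Rightarrow> real \<Rightarrow> complex" where
  "exp_primitive \<omega> t =
    (if \<omega> = 0 then of_real t else (1 - exp (- \<i> * of_real \<omega> * of_real t)) / (\<i> * of_real \<omega>))"

lemma primitive_exp:
  assumes t: "0 \<le> t"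
  shows "primitive (\<lambda>\<tau>. exp (- \<i> * of_real \<omega> * of_real \<tau>)) t = exp_primitive \<omega> t"
proof -
  have "((\<lambda>\<tau>. exp (- \<i> * of_real \<omega> * of_real \<tau>)) has_integral (exp_primitive \<omega> t - exp_primitive \<omega> 0)) {0..t}"
  proof (rule fundamental_theorem_of_calculus[OF t])
    fix \<tau> assume "\<tau> \<in> {0..t}"
    show "(exp_primitive \<omega> has_vector_derivative exp (- \<i> * of_real \<omega> * of_real \<tau>)) (at \<tau> within {0..t})"
    proof (cases "\<omega> = 0")
      case False
      then show ?thesis unfolding exp_primitive_def
        by (auto intro!: derivative_eq_intros has_vector_derivative_real_field simp: field_simps)
    next
      case True
      then show ?thesis unfolding exp_primitive_def
        by (auto intro!: derivative_eq_intros)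
    qed
  qed
  moreover have "set_integrable lborel {0..t} (\<lambda>\<tau>. exp (- \<i> * of_real \<omega> * of_real \<tau>))"
    by (intro borel_integrable_atLeastAtMost' continuous_intros)
  ultimately show ?thesis
    by (simp add: volterra_conv_def set_borel_integral_eq_integral(2) integral_unique exp_primitive_def)
qed

lemma norm_exp_primitive_le:
  assumes t: "0 \<le> t"
  shows "norm (exp_primitive \<omega> t) \<le> (t + 2) * (1 / sqrt (1 + \<omega>\<^sup>2))"
proof (rule le_divide_sqrt_weight)
  have int: "set_integrable lborel {0..t} (\<lambda>\<tau>. exp (- \<i> * of_real \<omega> * of_real \<tau>))"
    by (intro borel_integrable_atLeastAtMost' continuous_intros)
  have "norm (exp_primitive \<omega> t) \<le> (LINT \<tau>:{0..t}|lborel. norm (exp (- \<i> * of_real \<omega> * of_real \<tau>)))"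
    using set_integral_norm_bound[OF int] primitive_exp[OF t, of \<omega>]
    by (simp add: volterra_conv_def)
  also have "\<dots> = t" using t by (simp add: norm_exp_eq_Re set_lebesgue_integral_def)
  finally show "norm (exp_primitive \<omega> t) \<le> t" .
  have "norm (1 - exp (- \<i> * of_real \<omega> * of_real t)) \<le> 1 + 1"
    using norm_triangle_ineq4[of 1 "exp (- \<i> * of_real \<omega> * of_real t)"] by (simp add: norm_exp_eq_Re)
  then show "norm (exp_primitive \<omega> t) * \<bar>\<omega>\<bar> \<le> 2"
    by (simp add: exp_primitive_def norm_divide norm_mult)
qed simp

lemma laplace_exp_primitive:
  assumes s: "s > 0"
  shows "laplace_integrable (exp_primitive \<omega>) s"
    "laplace (exp_primitive \<omega>) s = 1 / (of_real s * (of_real s + \<i> * of_real \<omega>))"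
proof -
  note * = laplace_volterra_conv[OF laplace_one(1)[OF s] laplace_exp(1)[OF s, of \<omega>]]
  have eq: "indicator {0..} t *\<^sub>R exp (- (s * t)) *\<^sub>R primitive (\<lambda>\<tau>. exp (- \<i> * of_real \<omega> * of_real \<tau>)) t
    = indicator {0..} t *\<^sub>R exp (- (s * t)) *\<^sub>R exp_primitive \<omega> t" for t
    using primitive_exp[of t \<omega>] by (auto simp: indicator_def)
  show "laplace_integrable (exp_primitive \<omega>) s"
    using *(1) unfolding laplace_integrable_def set_integrable_def eq .
  show "laplace (exp_primitive \<omega>) s = 1 / (of_real s * (of_real s + \<i> * of_real \<omega>))"
    using *(2) unfolding laplace_def set_lebesgue_integral_def eq
    unfolding set_lebesgue_integral_def[symmetric] laplace_def[symmetric] laplace_one(2)[OF s] laplace_exp(2)[OF s] by simp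
qed

text \<open>What \<open>\<one> \<star> K\<close> has to be if \<open>K\<close> is the Fourier
  transform of \<open>lam\<close>; unlike the integral for \<open>K\<close>, this one converges
  absolutely for every measure in \<^const>\<open>M1_plus\<close>.\<close>

definition transform_primitive :: "real measure \<Rightarrow> real \<Rightarrow> complex" where
  "transform_primitive lam t = (CLINT \<omega>|lam. exp_primitive \<omega> t)"

lemma measurable_exp_primitive [measurable]:
  "(\<lambda>(\<omega>, t). exp_primitive \<omega> t) \<in> borel_measurable (borel \<Otimes>\<^sub>M borel)"
  unfolding exp_primitive_def by measurable

lemma Q_R_imaginary_axis:
  assumes "v > 0"
  shows "\<i> / (of_real pi * (\<i> * of_real v - of_real s)) = 1 / (of_real pi * (of_real v + \<i> * of_real s))"
proof -
  have "\<i> * of_real v - of_real s = \<i> * (of_real v + \<i> * of_real s)" by (simp add: algebra_simps)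
  moreover have "of_real v + \<i> * of_real s \<noteq> 0" using assms by (auto simp: complex_eq_iff)
  ultimately show ?thesis by (simp add: mult.left_commute[of _ \<i>])
qed

text \<open>Fubini's theorem. The inner Laplace transform is \<open>1 / (s (s + i
  \<omega>))\<close>, which is the kernel of \<open>Q_R\<close> on the imaginary axis up to
  constants.\<close>

lemma laplace_transform_primitive:
  assumes lam: "lam \<in> M1_plus" and s: "s > 0"
  shows "laplace_integrable (transform_primitive lam) s"
    "laplace (transform_primitive lam) s = of_real pi * Q_R lam (\<i> * of_real s) / of_real s"
proof -
  note M = M1_plusD[OF lam]
  note [measurable_cong] = M(1)
  interpret sigma_finite_measure lam by (rule M)
  interpret P: pair_sigma_finite lam lborel ..
  let ?h = "\<lambda>\<omega> t. indicator {0..} t *\<^sub>R exp (- (s * t)) *\<^sub>R exp_primitive \<omega> t"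
  have meas: "(\<lambda>(\<omega>, t). ?h \<omega> t) \<in> borel_measurable (lam \<Otimes>\<^sub>M lborel)"
    by measurable
  define W where "W t = norm (indicator {0..} t *\<^sub>R exp (- (s * t)) *\<^sub>R (primitive (\<lambda>_. 1) t + 2 * 1))" for t
  have "laplace_integrable (\<lambda>t. primitive (\<lambda>_. 1) t + 2 * 1) s"
    by (intro laplace_add(1) laplace_volterra_conv laplace_cmult(1) laplace_one(1)[OF s])
  then have W: "integrable lborel W"
    unfolding W_def[abs_def] laplace_integrable_def set_integrable_def by (rule integrable_norm)
  have W_eq: "W t = indicator {0..} t * exp (- (s * t)) * (t + 2)" for t
  proof (cases "0 \<le> t")
    case True
    have "primitive (\<lambda>_. 1) t = of_real t"
      using True by (simp add: volterra_conv_def set_lebesgue_integral_def scaleR_conv_of_real)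
    moreover have "norm (of_real t + 2 :: complex) = t + 2"
      using True by (metis abs_of_nonneg add_nonneg_nonneg norm_of_real of_real_add of_real_numeral zero_le_numeral)
    ultimately show ?thesis using True by (simp add: W_def)
  qed (simp add: W_def)
  have hW: "norm (?h \<omega> t) \<le> (1 / sqrt (1 + \<omega>\<^sup>2)) * W t" for \<omega> t
  proof (cases "0 \<le> t")
    case True
    then have "exp (- (s * t)) * norm (exp_primitive \<omega> t) \<le> exp (- (s * t)) * ((t + 2) * (1 / sqrt (1 + \<omega>\<^sup>2)))"
      by (intro mult_left_mono norm_exp_primitive_le) auto
    then show ?thesis using True by (simp add: W_eq)
  qed (simp add: W_eq)
  have int: "integrable (lam \<Otimes>\<^sub>M lborel) (\<lambda>(\<omega>, t). ?h \<omega> t)"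
  proof (rule P.Fubini_integrable[OF meas])
    have hi: "integrable lborel (?h \<omega>)" for \<omega>
      using laplace_exp_primitive(1)[OF s, of \<omega>] by (simp add: laplace_integrable_def set_integrable_def)
    then show "AE \<omega> in lam. integrable lborel (\<lambda>t. case (\<omega>, t) of (\<omega>, t) \<Rightarrow> ?h \<omega> t)"
      by simp
    show "integrable lam (\<lambda>\<omega>. LINT t|lborel. norm (case (\<omega>, t) of (\<omega>, t) \<Rightarrow> ?h \<omega> t))"
    proof (rule Bochner_Integration.integrable_bound)
      show "integrable lam (\<lambda>\<omega>. (1 / sqrt (1 + \<omega>\<^sup>2)) * (LINT t|lborel. W t))"
        by (intro integrable_mult_left M(3))
      show "(\<lambda>\<omega>. LINT t|lborel. norm (case (\<omega>, t) of (\<omega>, t) \<Rightarrow> ?h \<omega> t)) \<in> borel_measurable lam"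
        using meas by (intro lborel.borel_measurable_lebesgue_integral) (simp add: split_beta')
      have "(LINT t|lborel. norm (?h \<omega> t)) \<le> (LINT t|lborel. (1 / sqrt (1 + \<omega>\<^sup>2)) * W t)" for \<omega>
        using hi by (intro integral_mono hW integrable_norm integrable_mult_right W) auto
      then have le: "(LINT t|lborel. norm (?h \<omega> t)) \<le> (1 / sqrt (1 + \<omega>\<^sup>2)) * (LINT t|lborel. W t)" for \<omega>
        by simp
      have nonneg: "(LINT t|lborel. norm (?h \<omega> t)) \<ge> 0" for \<omega>
        by (intro Bochner_Integration.integral_nonneg) auto
      show "AE \<omega> in lam. norm (LINT t|lborel. norm (case (\<omega>, t) of (\<omega>, t) \<Rightarrow> ?h \<omega> t))
          \<le> norm ((1 / sqrt (1 + \<omega>\<^sup>2)) * (LINT t|lborel. W t))"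
        unfolding case_prod_conv real_norm_def
        by (intro AE_I2) (rule order_trans[OF eq_refl[OF abs_of_nonneg[OF nonneg]] order_trans[OF le abs_ge_self]])
    qed
  qed
  have hk: "(\<integral>\<omega>. ?h \<omega> t \<partial>lam) = indicator {0..} t *\<^sub>R exp (- (s * t)) *\<^sub>R transform_primitive lam t" for t
    by (simp add: transform_primitive_def)
  show "laplace_integrable (transform_primitive lam) s"
    using P.integrable_snd[OF int] unfolding hk laplace_integrable_def set_integrable_def .
  have "laplace (transform_primitive lam) s = (\<integral>t. (\<integral>\<omega>. ?h \<omega> t \<partial>lam) \<partial>lborel)"
    unfolding hk laplace_def set_lebesgue_integral_def ..
  also have "\<dots> = (\<integral>\<omega>. (\<integral>t. ?h \<omega> t \<partial>lborel) \<partial>lam)"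
    by (rule P.Fubini_integral[OF int])
  also have "\<dots> = (\<integral>\<omega>. (of_real pi / of_real s) * (\<i> / (of_real pi * (\<i> * of_real s - of_real \<omega>))) \<partial>lam)"
  proof (intro Bochner_Integration.integral_cong refl)
    fix \<omega>
    have "(\<integral>t. ?h \<omega> t \<partial>lborel) = laplace (exp_primitive \<omega>) s"
      by (simp add: laplace_def set_lebesgue_integral_def)
    then show "(\<integral>t. ?h \<omega> t \<partial>lborel) = (of_real pi / of_real s) * (\<i> / (of_real pi * (\<i> * of_real s - of_real \<omega>)))"
      using s by (simp add: laplace_exp_primitive(2) Q_R_imaginary_axis)
  qed
  also have "\<dots> = of_real pi * Q_R lam (\<i> * of_real s) / of_real s"
    unfolding integral_mult_right_zero Q_R_def by simp
  finally show "laplace (transform_primitive lam) s = of_real pi * Q_R lam (\<i> * of_real s) / of_real s" .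
qed

lemma measurable_fourier:
  assumes [measurable]: "\<phi> \<in> borel_measurable borel"
  shows "fourier \<phi> \<in> borel_measurable borel"
  unfolding fourier_def
  by (intro lborel.borel_measurable_lebesgue_integral) measurable

text \<open>For finite \<open>lam\<close> this is Fubini's theorem. Otherwise \<open>K\<close>
  is only given by its pairings with test functions; the smooth approximations of the indicator
  function of \<open>{0..t}\<close> turn these into a primitive in the limit, by dominated
  convergence on both sides.\<close>

lemma primitive_eq_transform_primitive:
  assumes K: "is_fourier_of K lam" and Kint: "locally_integrable K" and lam: "lam \<in> M1_plus" and t: "0 \<le> t"
  shows "primitive K t = transform_primitive lam t"
proof -
  note M = M1_plusD[OF lam]
  note [measurable_cong] = M(1)
  interpret sigma_finite_measure lam by (rule M)
  interpret P: pair_sigma_finite lam lborel ..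
  have E: "exp_primitive \<omega> t = (\<integral>\<tau>. indicator {0..t} \<tau> *\<^sub>R exp (- \<i> * of_real \<omega> * of_real \<tau>) \<partial>lborel)" for \<omega>
    using primitive_exp[OF t, of \<omega>] by (simp add: volterra_conv_def set_lebesgue_integral_def)
  show ?thesis
  proof (cases "finite_measure lam")
    case True
    interpret finite_measure lam by fact
    have Keq: "K s = (CLINT \<omega>|lam. exp (- \<i> * of_real \<omega> * of_real s))" for s
      using K True by (simp add: is_fourier_of_def)
    let ?f = "\<lambda>\<omega> \<tau>. indicator {0..t} \<tau> *\<^sub>R exp (- \<i> * of_real \<omega> * of_real \<tau>)"
    have int: "integrable (lam \<Otimes>\<^sub>M lborel) (\<lambda>(\<omega>, \<tau>). ?f \<omega> \<tau>)"
    proof (rule P.Fubini_integrable)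
      show "(\<lambda>(\<omega>, \<tau>). ?f \<omega> \<tau>) \<in> borel_measurable (lam \<Otimes>\<^sub>M lborel)" by measurable
      have "norm (?f \<omega> \<tau>) = indicator {0..t} \<tau>" for \<omega> \<tau> by (simp add: norm_exp_eq_Re)
      then show "integrable lam (\<lambda>\<omega>. LINT \<tau>|lborel. norm (case (\<omega>, \<tau>) of (\<omega>, \<tau>) \<Rightarrow> ?f \<omega> \<tau>))"
        by simp
      have "integrable lborel (?f \<omega>)" for \<omega>
        unfolding set_integrable_def[symmetric]
        by (intro borel_integrable_atLeastAtMost' continuous_intros)
      then show "AE \<omega> in lam. integrable lborel (\<lambda>\<tau>. case (\<omega>, \<tau>) of (\<omega>, \<tau>) \<Rightarrow> ?f \<omega> \<tau>)" by simp
    qed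
    have "primitive K t = (\<integral>\<tau>. (\<integral>\<omega>. ?f \<omega> \<tau> \<partial>lam) \<partial>lborel)"
      by (simp add: volterra_conv_def set_lebesgue_integral_def Keq)
    also have "\<dots> = (\<integral>\<omega>. (\<integral>\<tau>. ?f \<omega> \<tau> \<partial>lborel) \<partial>lam)"
      by (rule P.Fubini_integral[OF int])
    also have "\<dots> = transform_primitive lam t" by (simp add: transform_primitive_def E)
    finally show ?thesis .
  next
    case False
    then have test: "(CLINT s|lborel. K s * \<phi> s) = (CLINT \<omega>|lam. fourier \<phi> \<omega>)" if "test_function \<phi>" for \<phi>
      using K that by (simp add: is_fourier_of_def)
    obtain \<phi> :: "nat \<Rightarrow> real \<Rightarrow> complex" where
      tf: "\<And>n. test_function (\<phi> n)" and cont: "\<And>n. continuous_on UNIV (\<phi> n)" and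
      bnd: "\<And>n s. norm (\<phi> n s) \<le> indicator {0..t+1} s" and
      lim: "\<And>s. (\<lambda>n. \<phi> n s) \<longlonglongrightarrow> indicator {0<..t} s" and
      fbnd: "\<And>n \<omega>. norm (fourier (\<phi> n) \<omega>) \<le> (t + 3) * (1 / sqrt (1 + \<omega>\<^sup>2))"
      using smooth_indicator_approximation[OF t] by blast
    have [measurable]: "\<phi> n \<in> borel_measurable borel" for n
      using cont by (rule borel_measurable_continuous_onI)
    let ?K = "\<lambda>s. indicator {0..t+1} s *\<^sub>R K s"
    have iK: "integrable lborel ?K"
      using Kint by (simp add: locally_integrable_def set_integrable_def)
    have [measurable]: "?K \<in> borel_measurable borel" using borel_measurable_integrable[OF iK] by simp
    have zero: "\<phi> n s = 0" if "s \<notin> {0..t+1}" for n s using bnd[of n s] that by simp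
    have Kphi: "K s * \<phi> n s = ?K s * \<phi> n s" for n s using zero[of s n] by (cases "s \<in> {0..t+1}") auto
    have "(\<lambda>n. CLINT s|lborel. ?K s * \<phi> n s) \<longlonglongrightarrow> (CLINT s|lborel. ?K s * indicator {0<..t} s)"
    proof (rule integral_dominated_convergence)
      show "integrable lborel (\<lambda>s. norm (?K s))" using iK by (rule integrable_norm)
      show "AE s in lborel. (\<lambda>n. ?K s * \<phi> n s) \<longlonglongrightarrow> ?K s * indicator {0<..t} s"
        by (intro AE_I2 tendsto_mult tendsto_const lim)
      have "norm (\<phi> n s) \<le> 1" for n s using bnd[of n s] by (rule order_trans) (simp add: indicator_def)
      then show "AE s in lborel. norm (?K s * \<phi> n s) \<le> norm (?K s)" for n
        unfolding norm_mult by (intro AE_I2 mult_right_le_one_le) auto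
    qed measurable
    also have "(CLINT s|lborel. ?K s * indicator {0<..t} s) = primitive K t"
    proof -
      have "(CLINT s|lborel. ?K s * indicator {0<..t} s) = (CLINT s|lborel. ?K s * indicator {0..t} s)"
      proof (rule integral_cong_AE)
        show "AE s in lborel. ?K s * indicator {0<..t} s = ?K s * indicator {0..t} s"
          using AE_lborel_singleton[of 0] by eventually_elim (auto simp: indicator_def)
      qed measurable
      also have "\<dots> = primitive K t"
        unfolding volterra_conv_def set_lebesgue_integral_def
        by (intro Bochner_Integration.integral_cong) (auto simp: indicator_def)
      finally show ?thesis .
    qed
    finally have 1: "(\<lambda>n. CLINT s|lborel. K s * \<phi> n s) \<longlonglongrightarrow> primitive K t"
      by (simp only: Kphi)
    have flim: "(\<lambda>n. fourier (\<phi> n) \<omega>) \<longlonglongrightarrow> exp_primitive \<omega> t" for \<omega>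
    proof -
      have "(\<lambda>n. fourier (\<phi> n) \<omega>) \<longlonglongrightarrow> (CLINT s|lborel. exp (- \<i> * of_real \<omega> * of_real s) * indicator {0<..t} s)"
        unfolding fourier_def
      proof (rule integral_dominated_convergence)
        show "integrable lborel (\<lambda>s. indicator {0..t+1} s :: real)"
          by (rule integrable_real_indicator) (auto simp: emeasure_lborel_Icc_eq)
        show "AE s in lborel. (\<lambda>n. exp (- \<i> * of_real \<omega> * of_real s) * \<phi> n s) \<longlonglongrightarrow> exp (- \<i> * of_real \<omega> * of_real s) * indicator {0<..t} s"
          by (intro AE_I2 tendsto_mult tendsto_const lim)
        show "AE s in lborel. norm (exp (- \<i> * of_real \<omega> * of_real s) * \<phi> n s) \<le> indicator {0..t+1} s" for n
          using bnd[of n] by (simp add: norm_mult norm_exp_eq_Re)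
      qed measurable
      also have "(CLINT s|lborel. exp (- \<i> * of_real \<omega> * of_real s) * indicator {0<..t} s) = exp_primitive \<omega> t"
        unfolding E
      proof (rule integral_cong_AE)
        show "AE s in lborel. exp (- \<i> * of_real \<omega> * of_real s) * indicator {0<..t} s =
            indicator {0..t} s *\<^sub>R exp (- \<i> * of_real \<omega> * of_real s)"
          using AE_lborel_singleton[of 0] by eventually_elim (auto simp: indicator_def)
      qed measurable
      finally show ?thesis .
    qed
    have "(\<lambda>n. CLINT \<omega>|lam. fourier (\<phi> n) \<omega>) \<longlonglongrightarrow> transform_primitive lam t"
      unfolding transform_primitive_def
    proof (rule integral_dominated_convergence)
      show "integrable lam (\<lambda>\<omega>. (t + 3) * (1 / sqrt (1 + \<omega>\<^sup>2)))"
        by (intro integrable_mult_right M(3))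
      show "(\<lambda>\<omega>. exp_primitive \<omega> t) \<in> borel_measurable lam" by measurable
      show "fourier (\<phi> n) \<in> borel_measurable lam" for n
        using measurable_fourier[of "\<phi> n"] by measurable
    qed (use flim fbnd in auto)
    then show ?thesis
      using 1 LIMSEQ_unique unfolding test[OF tf] by blast
  qed
qed

lemma locally_integrable_imp_half_line_integrable:
  "locally_integrable K \<Longrightarrow> half_line_integrable K"
  by (simp add: locally_integrable_def half_line_integrable_def)

lemma locally_integrable_of_fourier:
  assumes J: "is_fourier_of J mu" and mu: "mu \<in> M1_plus"
  shows "locally_integrable J" "finite_measure mu \<Longrightarrow> continuous_on UNIV J"
proof -
  note M = M1_plusD[OF mu]
  note [measurable_cong] = M(1)
  show c: "continuous_on UNIV J" if fin: "finite_measure mu"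
  proof -
    interpret finite_measure mu by fact
    have Jeq: "J = (\<lambda>t. CLINT \<omega>|mu. exp (- \<i> * of_real \<omega> * of_real t))"
      using J fin by (auto simp: is_fourier_of_def)
    show ?thesis unfolding Jeq continuous_on_sequentially comp_def
    proof (intro allI ballI impI)
      fix u :: "nat \<Rightarrow> real" and a assume "(\<forall>n. u n \<in> UNIV) \<and> u \<longlonglongrightarrow> a"
      then have ua: "u \<longlonglongrightarrow> a" by simp
      show "(\<lambda>n. CLINT \<omega>|mu. exp (- \<i> * of_real \<omega> * of_real (u n))) \<longlonglongrightarrow> (CLINT \<omega>|mu. exp (- \<i> * of_real \<omega> * of_real a))"
      proof (rule integral_dominated_convergence)
        show "integrable mu (\<lambda>_. 1 :: real)" by simp
        show "AE \<omega> in mu. (\<lambda>n. exp (- \<i> * of_real \<omega> * of_real (u n))) \<longlonglongrightarrow> exp (- \<i> * of_real \<omega> * of_real a)"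
          by (intro AE_I2 tendsto_exp tendsto_mult tendsto_const tendsto_of_real ua)
      qed (auto simp: norm_exp_eq_Re)
    qed
  qed
  show "locally_integrable J"
  proof (cases "finite_measure mu")
    case True
    show ?thesis unfolding locally_integrable_def
      by (intro allI borel_integrable_atLeastAtMost' continuous_on_subset[OF c[OF True]]) auto
  qed (use J in \<open>simp add: is_fourier_of_def\<close>)
qed

section \<open>Behaviour of the transform on the imaginary axis\<close>

lemma Q_R_imaginary_axis_integrable:
  assumes lam: "lam \<in> M1_plus" and v: "v > 0"
  shows "integrable lam (\<lambda>s. 1 / (of_real pi * (of_real v + \<i> * of_real s)) :: complex)"
proof (rule Bochner_Integration.integrable_bound)
  note M = M1_plusD[OF lam]
  note [measurable_cong] = M(1)
  show "integrable lam (\<lambda>s. (1 / v + 1) * (1 / sqrt (1 + s\<^sup>2)))"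
    by (intro integrable_mult_right M(3))
  show "(\<lambda>s. 1 / (of_real pi * (of_real v + \<i> * of_real s)) :: complex) \<in> borel_measurable lam"
    by measurable
  have "norm (1 / (of_real pi * (of_real v + \<i> * of_real s)) :: complex) \<le> (1 / v + 1) * (1 / sqrt (1 + s\<^sup>2))" for s
  proof (rule le_divide_sqrt_weight)
    let ?n = "norm (of_real v + \<i> * of_real s :: complex)"
    have n: "v \<le> ?n" "\<bar>s\<bar> \<le> ?n"
      using complex_Re_le_cmod[of "of_real v + \<i> * of_real s"] abs_Im_le_cmod[of "of_real v + \<i> * of_real s"] by simp_all
    then have n0: "0 < ?n" using v by linarith
    have pn: "1 * ?n \<le> pi * ?n" using pi_gt3 n0 by (intro mult_right_mono) auto
    have nrm: "norm (1 / (of_real pi * (of_real v + \<i> * of_real s)) :: complex) = 1 / (pi * ?n)"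
      by (simp add: norm_divide norm_mult)
    show "norm (1 / (of_real pi * (of_real v + \<i> * of_real s)) :: complex) \<le> 1 / v"
      unfolding nrm using pn n v by (intro divide_left_mono) (auto intro!: mult_pos_pos n0)
    show "norm (1 / (of_real pi * (of_real v + \<i> * of_real s)) :: complex) * \<bar>s\<bar> \<le> 1"
      proof -
      have "\<bar>s\<bar> \<le> pi * ?n" using pn n by linarith
      then show ?thesis unfolding nrm using n0 by (simp add: divide_le_eq_1_pos)
    qed
  qed simp
  then show "AE s in lam. norm (1 / (of_real pi * (of_real v + \<i> * of_real s)) :: complex)
      \<le> norm ((1 / v + 1) * (1 / sqrt (1 + s\<^sup>2)))"
    by (intro AE_I2) (metis abs_ge_self order_trans real_norm_def)
qed

lemma Re_Q_R_imaginary_axis: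
  assumes lam: "lam \<in> M1_plus" and v: "v > 0"
  shows "integrable lam (\<lambda>s. v / (pi * (v\<^sup>2 + s\<^sup>2)))"
    and "Re (Q_R lam (\<i> * of_real v)) = (LINT s|lam. v / (pi * (v\<^sup>2 + s\<^sup>2)))"
proof -
  have eq: "Re (1 / (of_real pi * (of_real v + \<i> * of_real s))) = v / (pi * (v\<^sup>2 + s\<^sup>2))" for s
  proof -
    have "1 / (of_real pi * (of_real v + \<i> * of_real s)) = of_real (1 / pi) * inverse (of_real v + \<i> * of_real s)"
      by (simp add: divide_inverse)
    moreover have "Re (of_real a * w) = a * Re w" for a w by simp
    moreover have "Re (inverse (of_real v + \<i> * of_real s)) = v / (v\<^sup>2 + s\<^sup>2)"
      by (simp add: divide_inverse)
    ultimately show ?thesis by simp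
  qed
  note int = Q_R_imaginary_axis_integrable[OF lam v]
  show "integrable lam (\<lambda>s. v / (pi * (v\<^sup>2 + s\<^sup>2)))"
    using integrable_Re[OF int] unfolding eq .
  have "Q_R lam (\<i> * of_real v) = (CLINT s|lam. 1 / (of_real pi * (of_real v + \<i> * of_real s)))"
    unfolding Q_R_def Q_R_imaginary_axis[OF v] ..
  then show "Re (Q_R lam (\<i> * of_real v)) = (LINT s|lam. v / (pi * (v\<^sup>2 + s\<^sup>2)))"
    using integral_Re[OF int] unfolding eq by simp
qed

lemma Re_Q_R_nonneg:
  assumes "lam \<in> M1_plus" "v > 0"
  shows "0 \<le> Re (Q_R lam (\<i> * of_real v))"
  unfolding Re_Q_R_imaginary_axis(2)[OF assms] using assms(2)
  by (intro Bochner_Integration.integral_nonneg) (auto intro!: divide_nonneg_nonneg mult_nonneg_nonneg add_nonneg_nonneg)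

text \<open>The real part of \<open>v Q_R mu (i v)\<close> is the integral of \<open>v\<^sup>2 /
  (\<pi> (v\<^sup>2 + s\<^sup>2))\<close>, and this integrand is at least \<open>1 / (2
  \<pi>)\<close> on \<open>{-v..v}\<close>.\<close>

lemma finite_measure_of_Q_R_decay:
  assumes mu: "mu \<in> M1_plus" and C: "\<And>v. v > 0 \<Longrightarrow> v * Re (Q_R mu (\<i> * of_real v)) \<le> C"
  shows "finite_measure mu"
proof
  note M = M1_plusD[OF mu]
  note [measurable_cong] = M(1)
  have fin: "emeasure mu {-v..v} < \<infinity>" for v
    using mu by (simp add: M1_plus_def locally_finite_borel_def)
  have *: "measure mu {-v..v} \<le> 2 * pi * C" if v: "v > 0" for v
  proof -
    note int = Re_Q_R_imaginary_axis[OF mu v]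
    have iv: "integrable mu (indicator {-v..v} :: real \<Rightarrow> real)"
      using fin[of v] M(1) by (intro integrable_real_indicator) auto
    have "measure mu {-v..v} = (LINT s|mu. indicator {-v..v} s)"
      using M by simp
    also have "\<dots> \<le> (LINT s|mu. (2 * pi * v) * (v / (pi * (v\<^sup>2 + s\<^sup>2))))"
    proof (rule integral_mono[OF iv])
      show "integrable mu (\<lambda>s. (2 * pi * v) * (v / (pi * (v\<^sup>2 + s\<^sup>2))))"
        using int(1) by (rule integrable_mult_right)
      fix s
      have eq: "(2 * pi * v) * (v / (pi * (v\<^sup>2 + s\<^sup>2))) = 2 * v\<^sup>2 / (v\<^sup>2 + s\<^sup>2)"
        by (simp add: power2_eq_square)
      have pos: "v\<^sup>2 + s\<^sup>2 > 0" using v by (simp add: add_pos_nonneg)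
      show "indicator {-v..v} s \<le> (2 * pi * v) * (v / (pi * (v\<^sup>2 + s\<^sup>2)))"
      proof (cases "s \<in> {-v..v}")
        case True
        then have "s\<^sup>2 \<le> v\<^sup>2" using v by (simp add: abs_le_square_iff[symmetric] abs_le_iff)
        then show ?thesis unfolding eq using pos True by (simp add: le_divide_eq)
      next
        case False
        then show ?thesis unfolding eq using pos by (simp add: less_imp_le)
      qed
    qed
    also have "\<dots> = (2 * pi) * (v * Re (Q_R mu (\<i> * of_real v)))"
      unfolding int(2) integral_mult_right_zero by simp
    also have "\<dots> \<le> (2 * pi) * C"
      using C[OF v] by (intro mult_left_mono) auto
    finally show ?thesis by simp
  qed
  have "emeasure mu (\<Union>n. {- real (Suc n)..real (Suc n)}) = (SUP n. emeasure mu {- real (Suc n)..real (Suc n)})"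
    by (intro SUP_emeasure_incseq[symmetric]) (auto simp: M incseq_def)
  also have "\<dots> \<le> ennreal (2 * pi * C)"
  proof (rule SUP_least)
    fix n
    have "emeasure mu {- real (Suc n)..real (Suc n)} = ennreal (measure mu {- real (Suc n)..real (Suc n)})"
      using fin[of "real (Suc n)"] by (intro emeasure_eq_ennreal_measure) auto
    also have "\<dots> \<le> ennreal (2 * pi * C)"
      by (intro ennreal_leI *) simp
    finally show "emeasure mu {- real (Suc n)..real (Suc n)} \<le> ennreal (2 * pi * C)" .
  qed
  also have "(\<Union>n. {- real (Suc n)..real (Suc n)}) = space mu"
  proof -
    have "\<exists>n. x \<in> {- real (Suc n)..real (Suc n)}" for x
    proof -
      obtain n where "\<bar>x\<bar> \<le> real n" using real_arch_simple by blast
      then have "x \<in> {- real (Suc n)..real (Suc n)}" by (auto simp: abs_le_iff)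
      then show ?thesis by blast
    qed
    then show ?thesis using M(2) by blast
  qed
  finally show "emeasure mu (space mu) \<noteq> \<infinity>"
    by (metis ennreal_less_top infinity_ennreal_def leD)
qed

lemma norm_Q_R_le_of_finite_measure:
  assumes mu: "mu \<in> M1_plus" and fin: "finite_measure mu" and v: "v > 0"
  shows "norm (Q_R mu (\<i> * of_real v)) \<le> measure mu UNIV / (pi * v)"
proof -
  interpret finite_measure mu by fact
  note int = Q_R_imaginary_axis_integrable[OF mu v]
  have "norm (Q_R mu (\<i> * of_real v)) \<le> (LINT s|mu. norm (1 / (of_real pi * (of_real v + \<i> * of_real s)) :: complex))"
    unfolding Q_R_def Q_R_imaginary_axis[OF v] by (rule integral_norm_bound)
  also have "\<dots> \<le> (LINT s|mu. 1 / (pi * v))"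
  proof (rule integral_mono[OF integrable_norm[OF int]])
    fix s
    let ?n = "norm (of_real v + \<i> * of_real s :: complex)"
    have "v \<le> ?n"
      using complex_Re_le_cmod[of "of_real v + \<i> * of_real s"] by simp
    then show "norm (1 / (of_real pi * (of_real v + \<i> * of_real s)) :: complex) \<le> 1 / (pi * v)"
      using v by (simp add: norm_divide norm_mult frac_le)
  qed simp
  also have "\<dots> = measure mu UNIV / (pi * v)" using M1_plusD(2)[OF mu] by simp
  finally show ?thesis .
qed

lemma B_R_imaginary_axis:
  assumes "B_R lam c0 c1 mu \<zeta>0 \<zeta>1" "v > 0"
  shows "(Q_R lam (\<i> * of_real v) - \<i> / of_real pi * c0 + of_real (c1 * v / pi)) *
    (Q_R mu (\<i> * of_real v) - \<i> / of_real pi * \<zeta>0 + of_real (\<zeta>1 * v / pi)) = 1"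
proof -
  have "Im (\<i> * of_real v) > 0" using assms(2) by simp
  then have "(Q_R lam (\<i> * of_real v) - \<i> / of_real pi * c0 - \<i> / of_real pi * of_real c1 * (\<i> * of_real v)) *
        (Q_R mu (\<i> * of_real v) - \<i> / of_real pi * \<zeta>0 - \<i> / of_real pi * of_real \<zeta>1 * (\<i> * of_real v)) = 1"
    using assms(1) unfolding B_R_def by blast
  moreover have "- (\<i> / of_real pi * of_real c * (\<i> * of_real v)) = of_real (c * v / pi)" for c
    by (simp add: complex_eq_iff)
  ultimately show ?thesis by (simp only: diff_conv_add_uminus)
qed

text \<open>On the imaginary axis all contributions to the real parts of both factors in
  \<^const>\<open>B_R\<close> are nonnegative. The first factor is therefore at least \<open>c1
  v / \<pi>\<close> in modulus, and the second one is at most \<open>\<pi> / (c1 v)\<close>.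
  This decay leaves no room for a linear or a constant term, nor for infinite mass.\<close>

lemma B_R_c1_pos:
  assumes lam: "lam \<in> M1_plus" and mu: "mu \<in> M1_plus" and B: "B_R lam c0 c1 mu \<zeta>0 \<zeta>1"
    and c0: "Im c0 \<ge> 0" and c1: "c1 > 0"
  shows "finite_measure mu" "\<zeta>0 = 0" "\<zeta>1 = 0"
proof -
  have z1: "\<zeta>1 \<ge> 0" and z0: "Im \<zeta>0 \<ge> 0" using B by (auto simp: B_R_def)
  define q2 where "q2 v = Q_R mu (\<i> * of_real v) - \<i> / of_real pi * \<zeta>0 + of_real (\<zeta>1 * v / pi)" for v
  have Re_q2: "Re (q2 v) = Re (Q_R mu (\<i> * of_real v)) + Im \<zeta>0 / pi + \<zeta>1 * v / pi" for v
    by (simp add: q2_def)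
  have bound: "norm (q2 v) \<le> pi / (c1 * v)" if v: "v > 0" for v
  proof -
    define q1 where "q1 = Q_R lam (\<i> * of_real v) - \<i> / of_real pi * c0 + of_real (c1 * v / pi)"
    have "Re q1 = Re (Q_R lam (\<i> * of_real v)) + Im c0 / pi + c1 * v / pi"
      by (simp add: q1_def)
    then have "c1 * v / pi \<le> Re q1"
      using Re_Q_R_nonneg[OF lam v] c0 by simp
    also have "\<dots> \<le> norm q1" by (rule complex_Re_le_cmod)
    finally have q1: "c1 * v / pi \<le> norm q1" .
    have "norm q1 * norm (q2 v) = 1"
      using B_R_imaginary_axis[OF B v] unfolding q1_def q2_def by (metis norm_mult norm_one)
    then have "c1 * v / pi * norm (q2 v) \<le> 1"
      using mult_right_mono[OF q1, of "norm (q2 v)"] by simp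
    then show ?thesis using c1 v by (simp add: field_simps)
  qed
  have Re_bound: "Re (Q_R mu (\<i> * of_real v)) + Im \<zeta>0 / pi + \<zeta>1 * v / pi \<le> pi / (c1 * v)" if "v > 0" for v
    using order_trans[OF complex_Re_le_cmod bound[OF that]] unfolding Re_q2 .
  have nonneg: "0 \<le> Re (Q_R mu (\<i> * of_real v))" "0 \<le> Im \<zeta>0 / pi" "0 \<le> \<zeta>1 * v / pi" if "v > 0" for v
    using Re_Q_R_nonneg[OF mu that] z0 z1 that by simp_all
  have "\<zeta>1 * v\<^sup>2 \<le> pi\<^sup>2 / c1" if v: "v > 0" for v
  proof -
    have "\<zeta>1 * v / pi \<le> pi / (c1 * v)" using Re_bound[OF v] nonneg[OF v] by linarith
    then show ?thesis using v c1 by (simp add: field_simps power2_eq_square)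
  qed
  show z1_eq: "\<zeta>1 = 0"
  proof (rule ccontr)
    assume "\<zeta>1 \<noteq> 0"
    then have "\<zeta>1 > 0" using z1 by simp
    define v where "v = sqrt (pi\<^sup>2 / c1 / \<zeta>1 + 1)"
    have "pi\<^sup>2 / c1 / \<zeta>1 \<ge> 0" using c1 \<open>\<zeta>1 > 0\<close> by simp
    then have "v > 0" "v\<^sup>2 = pi\<^sup>2 / c1 / \<zeta>1 + 1" by (simp_all add: v_def add_nonneg_pos)
    with \<open>\<zeta>1 > 0\<close> have "\<zeta>1 * v\<^sup>2 = pi\<^sup>2 / c1 + \<zeta>1" by (simp add: distrib_left)
    with \<open>\<And>v. v > 0 \<Longrightarrow> \<zeta>1 * v\<^sup>2 \<le> pi\<^sup>2 / c1\<close>[OF \<open>v > 0\<close>] \<open>\<zeta>1 > 0\<close> show False by simp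
  qed
  have "v * Re (Q_R mu (\<i> * of_real v)) \<le> pi / c1" if v: "v > 0" for v
  proof -
    have "Re (Q_R mu (\<i> * of_real v)) \<le> pi / (c1 * v)" using Re_bound[OF v] nonneg[OF v] by linarith
    then show ?thesis using v c1 by (simp add: field_simps)
  qed
  then show fin: "finite_measure mu" by (rule finite_measure_of_Q_R_decay[OF mu])
  define C where "C = pi * (pi / c1 + measure mu UNIV / pi)"
  have "norm \<zeta>0 * v \<le> C" if v: "v > 0" for v
  proof -
    have "norm (\<i> / of_real pi * \<zeta>0) = norm (Q_R mu (\<i> * of_real v) - q2 v)"
      by (simp add: q2_def z1_eq)
    also have "\<dots> \<le> measure mu UNIV / (pi * v) + pi / (c1 * v)"
      using norm_triangle_ineq4 norm_Q_R_le_of_finite_measure[OF mu fin v] bound[OF v] by (meson add_mono order_trans)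
    finally have "norm \<zeta>0 / pi \<le> measure mu UNIV / (pi * v) + pi / (c1 * v)"
      by (simp add: norm_mult norm_divide)
    then have "norm \<zeta>0 / pi * (pi * v) \<le> (measure mu UNIV / (pi * v) + pi / (c1 * v)) * (pi * v)"
      using v by (intro mult_right_mono) auto
    then show ?thesis using v c1 by (simp add: C_def algebra_simps)
  qed
  note z = this
  show "\<zeta>0 = 0"
  proof (rule ccontr)
    assume "\<zeta>0 \<noteq> 0"
    then have p: "norm \<zeta>0 > 0" by simp
    define v where "v = \<bar>C\<bar> / norm \<zeta>0 + 1"
    have "v > 0" using p by (simp add: v_def add_nonneg_pos)
    have "norm \<zeta>0 * v = \<bar>C\<bar> + norm \<zeta>0" using p by (simp add: v_def distrib_left)
    with z[OF \<open>v > 0\<close>] p show False by linarith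
  qed
qed

section \<open>Inversion of the Volterra equation\<close>

text \<open>The distribution \<open>c1 \<delta>' - i c0 \<delta> + K\<close> integrated twice,
  which is the least number of integrations that makes all three terms continuous.\<close>

definition twice_integrated_kernel :: "(real \<Rightarrow> complex) \<Rightarrow> complex \<Rightarrow> real \<Rightarrow> real \<Rightarrow> complex" where
  "twice_integrated_kernel K c0 c1 t =
     of_real c1 * 1 + (- \<i> * c0) * primitive (\<lambda>_. 1) t + primitive (primitive K) t"

lemma continuous_on_twice_integrated_kernel:
  assumes "half_line_integrable K"
  shows "continuous_on {0..} (twice_integrated_kernel K c0 c1)"
  unfolding twice_integrated_kernel_def[abs_def]
  by (intro continuous_intros continuous_on_primitive continuous_imp_half_line_integrable assms)

lemma laplace_twice_integrated_kernel:
  assumes K: "is_fourier_of K lam" "locally_integrable K" "lam \<in> M1_plus" and s: "s > 0"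
  shows "laplace_integrable (twice_integrated_kernel K c0 c1) s"
    "laplace (twice_integrated_kernel K c0 c1) s =
      of_real pi / (of_real s)\<^sup>2 * (Q_R lam (\<i> * of_real s) - \<i> / of_real pi * c0 + of_real (c1 * s / pi))"
proof -
  note one = laplace_one[OF s]
  note prim = laplace_cong[OF primitive_eq_transform_primitive[OF K(1,2,3)]]
  have 1: "laplace_integrable (primitive K) s" using laplace_transform_primitive(1)[OF K(3) s] prim(1) by simp
  have 2: "laplace (primitive K) s = of_real pi * Q_R lam (\<i> * of_real s) / of_real s"
    using laplace_transform_primitive(2)[OF K(3) s] prim(2) by simp
  note pp = laplace_volterra_conv[OF one(1) 1]
  note p1 = laplace_volterra_conv[OF one(1) one(1)]
  note a = laplace_cmult[OF one(1), of "of_real c1"]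
  note b = laplace_cmult[OF p1(1), of "- \<i> * c0"]
  note c = laplace_add[OF a(1) b(1)]
  note d = laplace_add[OF c(1) pp(1)]
  show "laplace_integrable (twice_integrated_kernel K c0 c1) s"
    using d(1) unfolding twice_integrated_kernel_def[abs_def] .
  have "laplace (twice_integrated_kernel K c0 c1) s = of_real c1 * (1 / of_real s) + - \<i> * c0 * (1 / of_real s * (1 / of_real s))
     + 1 / of_real s * (of_real pi * Q_R lam (\<i> * of_real s) / of_real s)"
    unfolding twice_integrated_kernel_def[abs_def] d(2) c(2) a(2) b(2) pp(2) p1(2) one(2) 2 ..
  also have "\<dots> = of_real pi / (of_real s)\<^sup>2 * (Q_R lam (\<i> * of_real s) - \<i> / of_real pi * c0 + of_real (c1 * s / pi))"
    using s by (simp add: field_simps power2_eq_square)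
  finally show "laplace (twice_integrated_kernel K c0 c1) s =
      of_real pi / (of_real s)\<^sup>2 * (Q_R lam (\<i> * of_real s) - \<i> / of_real pi * c0 + of_real (c1 * s / pi))" .
qed

text \<open>Both sides have Laplace transform \<open>\<pi>\<^sup>2 / s\<^sup>4\<close>: for the
  left one this is the relation \<^const>\<open>B_R\<close> at \<open>i s\<close>.\<close>

lemma twice_integrated_kernels_inverse:
  assumes K: "is_fourier_of K lam" "locally_integrable K" "lam \<in> M1_plus"
    and J: "is_fourier_of J mu" "locally_integrable J" "mu \<in> M1_plus"
    and B: "B_R lam c0 c1 mu \<zeta>0 \<zeta>1" and t: "0 \<le> t"
  shows "volterra_conv (twice_integrated_kernel J \<zeta>0 \<zeta>1) (twice_integrated_kernel K c0 c1) t =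
    of_real (pi\<^sup>2) * primitive (primitive (primitive (\<lambda>_. 1))) t"
proof -
  let ?A = "twice_integrated_kernel K c0 c1" and ?B = "twice_integrated_kernel J \<zeta>0 \<zeta>1"
  let ?P = "primitive (primitive (primitive (\<lambda>_. 1)))"
  let ?D = "\<lambda>t. volterra_conv ?B ?A t + - of_real (pi\<^sup>2) * ?P t"
  note Ki = locally_integrable_imp_half_line_integrable[OF K(2)] and Ji = locally_integrable_imp_half_line_integrable[OF J(2)]
  have L: "laplace_integrable ?D s \<and> laplace ?D s = 0" if s: "s > 0" for s
  proof -
    note one = laplace_one[OF s]
    note A = laplace_twice_integrated_kernel[OF K s, of c0 c1]
    note Bk = laplace_twice_integrated_kernel[OF J s, of \<zeta>0 \<zeta>1]
    note BA = laplace_volterra_conv[OF Bk(1) A(1)]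
    note p1 = laplace_volterra_conv[OF one(1) one(1)]
    note p2 = laplace_volterra_conv[OF one(1) p1(1)]
    note p3 = laplace_volterra_conv[OF one(1) p2(1)]
    note m = laplace_cmult[OF p3(1), of "- of_real (pi\<^sup>2)"]
    note d = laplace_add[OF BA(1) m(1)]
    have BR: "(Q_R lam (\<i> * of_real s) - \<i> / of_real pi * c0 + of_real (c1 * s / pi)) *
       (Q_R mu (\<i> * of_real s) - \<i> / of_real pi * \<zeta>0 + of_real (\<zeta>1 * s / pi)) = 1" (is "?q1 * ?q2 = 1")
      by (rule B_R_imaginary_axis[OF B s])
    have "laplace ?D s = of_real pi / (of_real s)\<^sup>2 * ?q2 * (of_real pi / (of_real s)\<^sup>2 * ?q1)
       + - of_real (pi\<^sup>2) * (1 / of_real s * (1 / of_real s * (1 / of_real s * (1 / of_real s))))"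
      unfolding d(2) BA(2) m(2) p3(2) p2(2) p1(2) one(2) A(2) Bk(2) ..
    also have "of_real pi / (of_real s)\<^sup>2 * ?q2 * (of_real pi / (of_real s)\<^sup>2 * ?q1) =
       (of_real pi / (of_real s)\<^sup>2 * (of_real pi / (of_real s)\<^sup>2)) * (?q1 * ?q2)"
      by (simp only: mult_ac)
    finally show ?thesis using d(1) s unfolding BR by (simp add: power2_eq_square)
  qed
  have "continuous_on {0..} (volterra_conv ?B ?A)"
    by (intro continuous_on_volterra_conv continuous_imp_half_line_integrable continuous_on_twice_integrated_kernel Ki Ji)
  moreover have "continuous_on {0..} ?P"
    by (intro continuous_on_primitive continuous_imp_half_line_integrable continuous_on_const)
  ultimately have Dc: "continuous_on {0..} ?D"
    by (intro continuous_on_add continuous_on_mult_left)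
  have "?D t = 0"
    by (rule laplace_eq_0_imp_eq_0[OF Dc L[OF zero_less_one, THEN conjunct1] L[THEN conjunct2] t])
  then show ?thesis by (simp only: add_eq_0_iff2 minus_mult_left minus_minus)
qed

text \<open>The equation for \<open>\<xi>\<close>, integrated twice. The initial value enters
  through the primitive of the derivative of \<open>\<xi>\<close>; for \<open>c1 = 0\<close> its
  coefficient vanishes.\<close>

lemma classical_solution_identities:
  assumes K: "half_line_integrable K" and sol: "classical_solution K c0 c1 x0 y \<xi>"
  shows "continuous_on {0..} y"
    "0 \<le> t \<Longrightarrow> primitive (primitive y) t + of_real c1 * x0 * primitive (\<lambda>_. 1) t =
        volterra_conv (twice_integrated_kernel K c0 c1) \<xi> t"
proof -
  have xc: "continuous_on {0..} \<xi>" using sol by (simp add: classical_solution_def)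
  define dx where "dx t = of_real c1 * half_line_deriv \<xi> t" for t
  have dxc: "continuous_on {0..} dx"
  proof (cases "c1 = 0")
    case False
    then show ?thesis using sol unfolding dx_def classical_solution_def by (intro continuous_intros) auto
  qed (simp add: dx_def)
  have y: "y t = dx t + (- \<i> * c0) * \<xi> t + volterra_conv K \<xi> t" if "0 \<le> t" for t
    using sol that by (simp add: classical_solution_def dx_def)
  have Kx: "continuous_on {0..} (volterra_conv K \<xi>)" by (rule continuous_on_volterra_conv[OF K xc])
  have c: "continuous_on {0..} (\<lambda>t. dx t + (- \<i> * c0) * \<xi> t + volterra_conv K \<xi> t)"
    by (intro continuous_intros dxc xc Kx)
  then show yc: "continuous_on {0..} y"
    by (rule continuous_on_cong[THEN iffD1, rotated 2]) (auto simp: y)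
  note one = half_line_integrable_one
  have pdx: "primitive dx t = of_real c1 * \<xi> t + - (of_real c1 * x0) * 1" if t: "0 \<le> t" for t
  proof (cases "c1 = 0")
    case False
    then have x0: "\<xi> 0 = x0" and diff: "\<xi> differentiable_on {0..}"
      using sol by (auto simp: classical_solution_def)
    have "((\<lambda>s. of_real c1 * \<xi> s) has_vector_derivative dx t) (at t within {0..})" if "0 \<le> t" for t
    proof -
      have "(\<xi> has_vector_derivative half_line_deriv \<xi> t) (at t within {0..})"
        using diff that by (intro vector_derivative_works[THEN iffD1]) (auto simp: differentiable_on_def)
      then show ?thesis unfolding dx_def by (rule has_vector_derivative_mult_right)
    qed
    from primitive_of_derivative[OF dxc this t] show ?thesis by (simp add: x0)
  next
    case True
    then show ?thesis by (simp add: dx_def[abs_def] volterra_conv_def)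
  qed
  have assoc1: "primitive (volterra_conv f \<xi>) = volterra_conv (primitive f) \<xi>" if "half_line_integrable f" for f
    using volterra_conv_assoc[OF one that xc] by auto
  have ppx: "primitive (primitive \<xi>) = volterra_conv (primitive (\<lambda>_. 1)) \<xi>"
    by (rule assoc1[OF one])
  have pKi: "half_line_integrable (primitive K)" by (intro continuous_imp_half_line_integrable continuous_on_primitive K)
  have ppKx: "primitive (primitive (volterra_conv K \<xi>)) = volterra_conv (primitive (primitive K)) \<xi>"
    by (simp only: assoc1[OF K] assoc1[OF pKi])
  have py: "primitive y t = of_real c1 * \<xi> t + - (of_real c1 * x0) * 1 + (- \<i> * c0) * primitive \<xi> t + primitive (volterra_conv K \<xi>) t"
    if t: "0 \<le> t" for t
  proof -
    have "primitive y t = primitive (\<lambda>t. dx t + (- \<i> * c0) * \<xi> t + volterra_conv K \<xi> t) t"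
      by (rule volterra_conv_cong) (simp_all add: y)
    also have "\<dots> = primitive dx t + (- \<i> * c0) * primitive \<xi> t + primitive (volterra_conv K \<xi>) t"
      by (simp only: volterra_conv_linear one dxc xc Kx)
    finally show ?thesis unfolding pdx[OF t] .
  qed
  have cp: "continuous_on {0..} (primitive f)" if "continuous_on {0..} f" for f
    by (intro continuous_on_primitive continuous_imp_half_line_integrable that)
  assume t: "0 \<le> t"
  have "primitive (primitive y) t =
      primitive (\<lambda>t. of_real c1 * \<xi> t + - (of_real c1 * x0) * 1 + (- \<i> * c0) * primitive \<xi> t + primitive (volterra_conv K \<xi>) t) t"
    by (rule volterra_conv_cong) (simp_all only: py)
  also have "\<dots> = of_real c1 * primitive \<xi> t + - (of_real c1 * x0) * primitive (\<lambda>_. 1) t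
     + (- \<i> * c0) * primitive (primitive \<xi>) t + primitive (primitive (volterra_conv K \<xi>)) t"
    by (simp only: volterra_conv_linear one cp xc Kx)
  finally have 1: "primitive (primitive y) t + of_real c1 * x0 * primitive (\<lambda>_. 1) t =
     of_real c1 * primitive \<xi> t + (- \<i> * c0) * volterra_conv (primitive (\<lambda>_. 1)) \<xi> t + volterra_conv (primitive (primitive K)) \<xi> t"
    unfolding ppx ppKx by simp
  have xi: "half_line_integrable \<xi>" using xc by (rule continuous_imp_half_line_integrable)
  have "volterra_conv (twice_integrated_kernel K c0 c1) \<xi> t = volterra_conv \<xi> (twice_integrated_kernel K c0 c1) t"
    by (rule volterra_conv_commute)
  also have "\<dots> = of_real c1 * volterra_conv \<xi> (\<lambda>_. 1) t + (- \<i> * c0) * volterra_conv \<xi> (primitive (\<lambda>_. 1)) t + volterra_conv \<xi> (primitive (primitive K)) t"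
    unfolding twice_integrated_kernel_def[abs_def]
    by (simp only: volterra_conv_linear xi cp continuous_on_primitive[OF K])
  finally show "primitive (primitive y) t + of_real c1 * x0 * primitive (\<lambda>_. 1) t =
        volterra_conv (twice_integrated_kernel K c0 c1) \<xi> t"
    unfolding 1 volterra_conv_commute[of \<xi>] by simp
qed

text \<open>Convolve the twice integrated equation with the kernel of the inverse and rearrange
  by associativity. Each side then carries two outer integrations, which are cancelled.\<close>

lemma twice_integrated_solution_formula:
  assumes K: "is_fourier_of K lam" "locally_integrable K" "lam \<in> M1_plus"
    and J: "is_fourier_of J mu" "locally_integrable J" "mu \<in> M1_plus"
    and B: "B_R lam c0 c1 mu \<zeta>0 \<zeta>1" and sol: "classical_solution K c0 c1 x0 y \<xi>"
    and t: "0 \<le> t"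
  shows "of_real \<zeta>1 * primitive y t + (- \<i> * \<zeta>0) * primitive (primitive y) t
      + primitive (primitive (volterra_conv J y)) t + of_real c1 * x0 * twice_integrated_kernel J \<zeta>0 \<zeta>1 t
     = of_real (pi\<^sup>2) * primitive (primitive \<xi>) t"
proof -
  let ?A = "twice_integrated_kernel K c0 c1" and ?B = "twice_integrated_kernel J \<zeta>0 \<zeta>1"
  note Ki = locally_integrable_imp_half_line_integrable[OF K(2)] and Ji = locally_integrable_imp_half_line_integrable[OF J(2)]
  note one = half_line_integrable_one
  have xc: "continuous_on {0..} \<xi>" using sol by (simp add: classical_solution_def)
  note yc = classical_solution_identities(1)[OF Ki sol] and main = classical_solution_identities(2)[OF Ki sol]
  have Bc: "continuous_on {0..} ?B" and Ac: "continuous_on {0..} ?A"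
    using continuous_on_twice_integrated_kernel Ji Ki by blast+
  note ci = continuous_imp_half_line_integrable
  have cp: "continuous_on {0..} (primitive f)" if "continuous_on {0..} f" for f
    by (intro continuous_on_primitive ci that)
  have oc: "continuous_on {0..} (\<lambda>_. 1 :: complex)" by (intro continuous_intros)
  have assoc1: "primitive (volterra_conv f h) = volterra_conv (primitive f) h"
    if "half_line_integrable f" "continuous_on {0..} h" for f h
    using volterra_conv_assoc[OF one that] by auto
  have comm1: "volterra_conv f (primitive h) = primitive (volterra_conv f h)"
    if f: "half_line_integrable f" and h: "continuous_on {0..} h" for f h
    using volterra_conv_left_commute[OF f one h] volterra_conv_assoc[OF f one h] by auto
  have By: "volterra_conv ?B y t = of_real \<zeta>1 * primitive y t + (- \<i> * \<zeta>0) * primitive (primitive y) t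
      + primitive (primitive (volterra_conv J y)) t" for t
  proof -
    have "volterra_conv ?B y t = volterra_conv y ?B t" by (rule volterra_conv_commute)
    also have "\<dots> = of_real \<zeta>1 * volterra_conv y (\<lambda>_. 1) t + (- \<i> * \<zeta>0) * volterra_conv y (primitive (\<lambda>_. 1)) t
        + volterra_conv y (primitive (primitive J)) t"
      unfolding twice_integrated_kernel_def[abs_def]
      by (simp only: volterra_conv_linear ci[OF yc] cp continuous_on_primitive[OF Ji])
    also have "volterra_conv y (primitive (primitive J)) = volterra_conv (primitive (primitive J)) y"
      by (rule ext, rule volterra_conv_commute)
    also have "\<dots> = primitive (primitive (volterra_conv J y))"
      by (simp only: assoc1[OF Ji yc] assoc1[OF ci[OF continuous_on_primitive[OF Ji]] yc])
    also have "volterra_conv y (primitive (\<lambda>_. 1)) = primitive (primitive y)"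
      unfolding comm1[OF ci[OF yc] oc] by (intro arg_cong[of _ _ primitive] ext volterra_conv_commute)
    also have "volterra_conv y (\<lambda>_. 1) t = primitive y t" by (rule volterra_conv_commute)
    finally show ?thesis .
  qed
  let ?L = "\<lambda>t. volterra_conv ?B y t + of_real c1 * x0 * ?B t"
  let ?R = "\<lambda>t. of_real (pi\<^sup>2) * primitive (primitive \<xi>) t"
  have Lc: "continuous_on {0..} ?L"
    by (rule continuous_on_add[OF continuous_on_volterra_conv[OF ci[OF Bc] yc] continuous_on_mult_left[OF Bc]])
  have Rc: "continuous_on {0..} ?R"
    by (rule continuous_on_mult_left[OF cp[OF cp[OF xc]]])
  have B1: "volterra_conv ?B (\<lambda>_. 1) = primitive ?B" by (rule ext, rule volterra_conv_commute)
  have pp: "primitive (primitive ?L) t = primitive (primitive ?R) t" if t: "0 \<le> t" for t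
  proof -
    have "primitive ?L = (\<lambda>t. primitive (volterra_conv ?B y) t + of_real c1 * x0 * primitive ?B t)"
      by (intro ext) (simp only: volterra_conv_linear one continuous_on_volterra_conv ci[OF Bc] Bc yc)
    then have "primitive (primitive ?L) t = primitive (primitive (volterra_conv ?B y)) t + of_real c1 * x0 * primitive (primitive ?B) t"
      by (simp only: volterra_conv_linear one continuous_on_volterra_conv cp ci[OF Bc] Bc yc)
    also have "\<dots> = volterra_conv ?B (primitive (primitive y)) t + of_real c1 * x0 * volterra_conv ?B (primitive (\<lambda>_. 1)) t"
      by (simp only: comm1[OF ci[OF Bc] cp[OF yc]] comm1[OF ci[OF Bc] yc] comm1[OF ci[OF Bc] oc] B1)
    also have "\<dots> = volterra_conv ?B (\<lambda>t. primitive (primitive y) t + of_real c1 * x0 * primitive (\<lambda>_. 1) t) t"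
      by (simp only: volterra_conv_linear ci[OF Bc] cp yc)
    also have "\<dots> = volterra_conv ?B (volterra_conv ?A \<xi>) t"
      by (rule volterra_conv_cong) (simp_all only: main)
    also have "\<dots> = volterra_conv (volterra_conv ?B ?A) \<xi> t"
      by (rule volterra_conv_assoc[OF ci[OF Bc] ci[OF Ac] xc, symmetric])
    also have "\<dots> = volterra_conv (\<lambda>t. of_real (pi\<^sup>2) * primitive (primitive (primitive (\<lambda>_. 1))) t) \<xi> t"
      by (rule volterra_conv_cong) (simp_all only: twice_integrated_kernels_inverse[OF K J B])
    also have "\<dots> = of_real (pi\<^sup>2) * volterra_conv (primitive (primitive (primitive (\<lambda>_. 1)))) \<xi> t"
      by (rule volterra_conv_mult_left)
    also have "volterra_conv (primitive (primitive (primitive (\<lambda>_. 1)))) \<xi> = primitive (primitive (primitive (primitive \<xi>)))"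
      by (simp only: assoc1[OF ci[OF cp[OF cp[OF oc]]] xc, symmetric] assoc1[OF ci[OF cp[OF oc]] xc, symmetric] assoc1[OF one xc, symmetric])
    also have "of_real (pi\<^sup>2) * primitive (primitive (primitive (primitive \<xi>))) t = primitive (primitive ?R) t"
      by (simp only: volterra_conv_mult_right[abs_def])
    finally show ?thesis .
  qed
  have "?L t = ?R t"
    using Lc Rc
  proof (rule primitive_cancel[OF _ _ _ t])
    show "primitive ?L t = primitive ?R t" if "0 \<le> t" for t
      by (rule primitive_cancel[OF cp[OF Lc] cp[OF Rc] pp that])
  qed
  then show ?thesis unfolding By .
qed

theorem proposition4p7:
  fixes K J x y :: "real \<Rightarrow> complex" and lam mu :: "real measure"
    and c0 \<zeta>0 x0 :: complex and c1 \<zeta>1 :: real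
  assumes "gPD K" and "is_fourier_of K lam" and "lam \<in> M1_plus"
    and "c1 \<ge> 0" and "Im c0 \<ge> 0"
    and "sufficiently_regular K c0 c1 x0 y"
    and "B_R lam c0 c1 mu \<zeta>0 \<zeta>1"
    and "is_fourier_of J mu" and "mu \<in> M1_plus"
    and "\<And>t. t \<ge> 0 \<Longrightarrow>
           of_real (pi\<^sup>2) * x t =
             of_real \<zeta>1 * half_line_deriv y t - \<i> * \<zeta>0 * y t + volterra_conv J y t
             + of_real c1 * x0 * J t"
  shows "(\<zeta>1 \<noteq> 0 \<longrightarrow> y differentiable_on {0..}) \<and> classical_solution K c0 c1 x0 y x"
proof -
  note x_eq = assms(10)
  note K = assms(2) locally_integrable_of_fourier(1)[OF assms(2,3)] assms(3)
  note J = assms(8) locally_integrable_of_fourier(1)[OF assms(8,9)] assms(9)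
  note B = assms(7)
  note Ki = locally_integrable_imp_half_line_integrable[OF K(2)] and Ji = locally_integrable_imp_half_line_integrable[OF J(2)]
  obtain \<xi> where sol: "classical_solution K c0 c1 x0 y \<xi>"
    using assms(6) by (auto simp: sufficiently_regular_def)
  have xc: "continuous_on {0..} \<xi>" using sol by (simp add: classical_solution_def)
  note yc = classical_solution_identities(1)[OF Ki sol]
  have Jyc: "continuous_on {0..} (volterra_conv J y)" by (rule continuous_on_volterra_conv[OF Ji yc])
  note id = twice_integrated_solution_formula[OF K J B sol]
  note one = half_line_integrable_one
  note ci = continuous_imp_half_line_integrable
  have cp: "continuous_on {0..} (primitive f)" if "continuous_on {0..} f" for f
    by (intro continuous_on_primitive ci that)
  \<comment> \<open>the solution provided by regularity of \<open>y\<close> agrees with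
    \<open>x\<close> on the half line, and being a classical solution only depends on the values
    there\<close>
  have core: "(\<zeta>1 \<noteq> 0 \<longrightarrow> y differentiable_on {0..}) \<and> (\<forall>t\<ge>0. x t = \<xi> t)"
  proof (cases "c1 = 0")
    case False
    then have c1: "c1 > 0" using assms(4) by simp
    note Z = B_R_c1_pos[OF K(3) J(3) B assms(5) c1]
    have Jc: "continuous_on {0..} J"
      using locally_integrable_of_fourier(2)[OF assms(8,9) Z(1)] by (rule continuous_on_subset) simp
    let ?L = "\<lambda>t. volterra_conv J y t + of_real c1 * x0 * J t" and ?R = "\<lambda>t. of_real (pi\<^sup>2) * \<xi> t"
    have Lc: "continuous_on {0..} ?L" and Rc: "continuous_on {0..} ?R"
      by (intro continuous_on_add continuous_on_mult_left Jyc Jc xc)+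
    have ppL: "primitive (primitive ?L) t = primitive (primitive ?R) t" if t: "0 \<le> t" for t
    proof -
      have "primitive ?L = (\<lambda>t. primitive (volterra_conv J y) t + of_real c1 * x0 * primitive J t)"
        by (intro ext) (simp only: volterra_conv_linear one Jyc Jc)
      then have "primitive (primitive ?L) t = primitive (primitive (volterra_conv J y)) t + of_real c1 * x0 * primitive (primitive J) t"
        by (simp only: volterra_conv_linear one cp Jyc Jc)
      also have "\<dots> = of_real (pi\<^sup>2) * primitive (primitive \<xi>) t"
        using id[OF t] by (simp add: Z twice_integrated_kernel_def)
      finally show ?thesis by (simp only: volterra_conv_mult_right[abs_def])
    qed
    have "?L t = ?R t" if "0 \<le> t" for t
      by (rule primitive_cancel[OF Lc Rc primitive_cancel[OF cp[OF Lc] cp[OF Rc] ppL] that])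
    then show ?thesis using x_eq by (simp add: Z)
  next
    case True
    \<comment> \<open>\<open>?R\<close> is what the second derivative of the integrated formula
      leaves besides \<open>\<zeta>1\<close> times the derivative of \<open>y\<close>; it is
      continuous, so its primitive is differentiable\<close>
    let ?R = "\<lambda>t. of_real (pi\<^sup>2) * \<xi> t + (\<i> * \<zeta>0) * y t + (-1) * volterra_conv J y t"
    have Rc: "continuous_on {0..} ?R" by (intro continuous_on_add continuous_on_mult_left xc yc Jyc)
    have pR: "primitive ?R t = of_real (pi\<^sup>2) * primitive \<xi> t + (\<i> * \<zeta>0) * primitive y t + (-1) * primitive (volterra_conv J y) t" for t
      by (simp only: volterra_conv_linear one xc yc Jyc)
    have ppR: "primitive (primitive ?R) t = of_real (pi\<^sup>2) * primitive (primitive \<xi>) t + (\<i> * \<zeta>0) * primitive (primitive y) t + (-1) * primitive (primitive (volterra_conv J y)) t" for t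
      unfolding pR
      by (simp only: volterra_conv_linear one cp xc yc Jyc)
    have Lc: "continuous_on {0..} (\<lambda>t. of_real \<zeta>1 * y t)" by (intro continuous_intros yc)
    have pL: "primitive (\<lambda>t. of_real \<zeta>1 * y t) t = primitive (primitive ?R) t" if t: "0 \<le> t" for t
      unfolding ppR using id[OF t] True by (simp add: volterra_conv_mult_right algebra_simps)
    have yR: "of_real \<zeta>1 * y t = primitive ?R t" if t: "0 \<le> t" for t
      by (rule primitive_cancel[OF Lc cp[OF Rc] pL t])
    show ?thesis
    proof (cases "\<zeta>1 = 0")
      case z1: True
      have R0: "?R t = 0" if t: "0 \<le> t" for t
      proof (rule primitive_cancel[OF Rc _ _ t, of "\<lambda>_. 0"])
        show "primitive ?R t = primitive (\<lambda>_. 0) t" if "0 \<le> t" for t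
          using yR[OF that] by (simp add: z1 volterra_conv_def)
      qed simp
      have "x t = \<xi> t" if t: "0 \<le> t" for t
      proof -
        have "of_real (pi\<^sup>2) * \<xi> t - of_real (pi\<^sup>2) * x t = ?R t"
          unfolding x_eq[OF t] by (simp add: True z1)
        then show ?thesis unfolding R0[OF t] by simp
      qed
      then show ?thesis using z1 by simp
    next
      case z1: False
      have dy: "(y has_vector_derivative ?R t / of_real \<zeta>1) (at t within {0..})" if t: "0 \<le> t" for t
      proof -
        have "((\<lambda>t. primitive ?R t / of_real \<zeta>1) has_vector_derivative ?R t / of_real \<zeta>1) (at t within {0..})"
          by (intro has_vector_derivative_divide primitive_has_vector_derivative[OF Rc t])
        then show ?thesis
          by (rule has_vector_derivative_transform[rotated 2]) (use t z1 yR in \<open>auto simp: field_simps\<close>)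
      qed
      then have "y differentiable_on {0..}"
        unfolding differentiable_on_def using differentiableI_vector by blast
      moreover have "x t = \<xi> t" if t: "0 \<le> t" for t
      proof -
        have "half_line_deriv y t = ?R t / of_real \<zeta>1"
          by (rule vector_derivative_within[OF at_within_half_line_neq_bot[OF t] dy[OF t]])
        then have "of_real \<zeta>1 * half_line_deriv y t = ?R t" using z1 by simp
        then have "of_real (pi\<^sup>2) * x t = of_real (pi\<^sup>2) * \<xi> t"
          using x_eq[OF t] True by simp
        then show ?thesis by simp
      qed
      ultimately show ?thesis by simp
    qed
  qed
  then have eq: "x t = \<xi> t" if "0 \<le> t" for t using that by simp
  have hd: "half_line_deriv x t = half_line_deriv \<xi> t" if "0 \<le> t" for t
    using that eq by (intro vector_derivative_cong_eq) (auto simp: eventually_at_filter)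
  have "classical_solution K c0 c1 x0 y x"
    unfolding classical_solution_def
  proof (intro conjI impI allI)
    show "continuous_on {0..} x" using xc by (rule continuous_on_cong[THEN iffD1, rotated 2]) (auto simp: eq)
    fix t :: real assume t: "t \<ge> 0"
    have "volterra_conv K x t = volterra_conv K \<xi> t" by (rule volterra_conv_cong) (auto simp: eq)
    then show "y t = of_real c1 * half_line_deriv x t - \<i> * c0 * x t + volterra_conv K x t"
      using sol t by (simp add: classical_solution_def eq hd)
  next
    assume c1: "c1 \<noteq> 0"
    then have s: "\<xi> 0 = x0" "\<xi> differentiable_on {0..}" "continuous_on {0..} (half_line_deriv \<xi>)"
      using sol by (auto simp: classical_solution_def)
    show "x 0 = x0" using s eq by simp
    show "x differentiable_on {0..}"
      using s(2) eq unfolding differentiable_on_def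
      by (metis atLeast_iff differentiable_transform_within zero_less_one)
    show "continuous_on {0..} (half_line_deriv x)"
      using s(3) by (rule continuous_on_cong[THEN iffD1, rotated 2]) (auto simp: hd)
  qed
  then show ?thesis using core by blast
qed

end
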